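(* Let $J$ be an orthogonal complex structure of class $C^1$ on $\mathbb{R}^{2n}$ (with the Euclidean metric) which is asymptotically constant. Then $J$ or $-J$ is isometrically equivalent to the standard constant orthogonal complex structure on $\mathbb{R}^{2n}=\mathbb{C}^n$.
   Context: An orthogonal complex structure (OCS) on a Riemannian manifold is an integrable almost complex structure (vanishing Nijenhuis tensor) orthogonal with respect to the metric. An OCS $J$ on $\mathbb{R}^{2n}$ is asymptotically constant if there is a constant OCS $J'$ such that $\|J(\mathbf{x})-J'\|\to0$ as $\mathbf{x}\to\infty$. Isometrically equivalent means carried to one another by conjugation with the differential of an isometry of $\mathbb{R}^{2n}$. *)

theory Defs
  imports "HOL-Analysis.Analysis"
begin

definition C1_map :: "('a::real_normed_vector \<Rightarrow> 'b::real_normed_vector) \<Rightarrow> bool" where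
  "C1_map f \<longleftrightarrow> (\<exists>f' :: 'a \<Rightarrow> 'a \<Rightarrow>\<^sub>L 'b.
      (\<forall>x. (f has_derivative blinfun_apply (f' x)) (at x)) \<and> continuous_on UNIV f')"

definition lie_bracket ::
    "('a::euclidean_space \<Rightarrow> 'a) \<Rightarrow> ('a \<Rightarrow> 'a) \<Rightarrow> 'a \<Rightarrow> 'a" where
  "lie_bracket X Y x = frechet_derivative Y (at x) (X x) - frechet_derivative X (at x) (Y x)"

text \<open>A field of endomorphisms of the tangent spaces is a map into \<open>'a \<Rightarrow>\<^sub>L 'a\<close>, which carries
  the operator norm.\<close>

definition nijenhuis ::
    "('a::euclidean_space \<Rightarrow> 'a \<Rightarrow>\<^sub>L 'a) \<Rightarrow> ('a \<Rightarrow> 'a) \<Rightarrow> ('a \<Rightarrow> 'a) \<Rightarrow> 'a \<Rightarrow> 'a" where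
  "nijenhuis J X Y x =
     lie_bracket (\<lambda>p. J p (X p)) (\<lambda>p. J p (Y p)) x
     - J x (lie_bracket (\<lambda>p. J p (X p)) Y x)
     - J x (lie_bracket X (\<lambda>p. J p (Y p)) x)
     - lie_bracket X Y x"

definition almost_complex_structure :: "('a::euclidean_space \<Rightarrow> 'a \<Rightarrow>\<^sub>L 'a) \<Rightarrow> bool" where
  "almost_complex_structure J \<longleftrightarrow> (\<forall>x v. J x (J x v) = - v)"

text \<open>The derivatives below are meaningful only for differentiable \<open>J\<close>; the regularity of \<open>J\<close> is
  a separate hypothesis (and automatic for constant \<open>J\<close>).\<close>

definition integrable_acs :: "('a::euclidean_space \<Rightarrow> 'a \<Rightarrow>\<^sub>L 'a) \<Rightarrow> bool" where
  "integrable_acs J \<longleftrightarrow> (\<forall>X Y. C1_map X \<longrightarrow> C1_map Y \<longrightarrow> (\<forall>x. nijenhuis J X Y x = 0))"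

definition orthogonal_complex_structure :: "('a::euclidean_space \<Rightarrow> 'a \<Rightarrow>\<^sub>L 'a) \<Rightarrow> bool" where
  "orthogonal_complex_structure J \<longleftrightarrow>
     almost_complex_structure J \<and> integrable_acs J \<and>
     (\<forall>x. orthogonal_transformation (blinfun_apply (J x)))"

definition asymptotically_constant :: "('a::euclidean_space \<Rightarrow> 'a \<Rightarrow>\<^sub>L 'a) \<Rightarrow> bool" where
  "asymptotically_constant J \<longleftrightarrow>
     (\<exists>J'. orthogonal_complex_structure (\<lambda>_. J') \<and>
           ((\<lambda>x. norm (J x - J')) \<longlongrightarrow> 0) at_infinity)"

definition euclidean_isometry :: "('a::euclidean_space \<Rightarrow> 'a) \<Rightarrow> bool" where
  "euclidean_isometry \<phi> \<longleftrightarrow> surj \<phi> \<and> (\<forall>x y. dist (\<phi> x) (\<phi> y) = dist x y)"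

definition isometrically_equivalent ::
    "('a::euclidean_space \<Rightarrow> 'a \<Rightarrow>\<^sub>L 'a) \<Rightarrow> ('a \<Rightarrow> 'a \<Rightarrow>\<^sub>L 'a) \<Rightarrow> bool" where
  "isometrically_equivalent J K \<longleftrightarrow>
     (\<exists>\<phi>. euclidean_isometry \<phi> \<and>
        (\<forall>x. blinfun_apply (K (\<phi> x)) =
             frechet_derivative \<phi> (at x) \<circ> blinfun_apply (J x) \<circ> inv (frechet_derivative \<phi> (at x))))"

text \<open>\<open>complex ^ 'n\<close>, with its real inner product, serves as Euclidean space of real dimension
  \<open>2 * CARD('n)\<close>; all derivatives above are real (Frechet) derivatives.\<close>

lift_definition standard_complex_structure :: "(complex ^ 'n) \<Rightarrow>\<^sub>L (complex ^ 'n)"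
  is "\<lambda>v. \<i> *s v"
  by (intro linear_conv_bounded_linear[THEN iffD1] linearI)
     (simp_all add: vec_eq_iff algebra_simps)

end

theory Submission
  imports Defs "HOL-Complex_Analysis.Conformal_Mappings"
begin

text \<open>
  Integrability and orthogonality together say that \<open>D\<^bsub>J v\<^esub> J = J \<circ> D\<^bsub>v\<^esub> J\<close>. Let \<open>J0\<close> be the
  limit structure. Wherever \<open>J\<close> is close to \<open>J0\<close>, the field \<open>N = 2 J0 (J + J0)\<^sup>-\<^sup>1\<close> is an affine
  coordinate of \<open>J\<close> in twistor space with \<open>N J = J0 N\<close>, and both \<open>N\<close> and \<open>W x = N x (x - p)\<close> are
  holomorphic maps from \<open>(\<real>\<^sup>2\<^sup>n, J)\<close> to spaces with the constant structure \<open>J0\<close>. Where \<open>W\<close> is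
  close to the identity it can be inverted, so that \<open>N \<circ> W\<^sup>-\<^sup>1\<close> is holomorphic in the ordinary sense.

  Applied to small balls this gives, through Cauchy's inequality and a scaling argument, the gradient
  estimate \<open>|DJ| \<le> C sup |J - J0| / \<rho>\<close> on balls of radius \<open>\<rho>\<close>. Hence \<open>|x| |DJ|\<close> tends to \<open>0\<close> at
  infinity, and \<open>W\<close> (with \<open>p = 0\<close>) is invertible outside a large ball. On a complex line that misses
  this ball the entire function \<open>N \<circ> W\<^sup>-\<^sup>1\<close> tends to the identity, so Liouville's theorem gives
  \<open>J = J0\<close> near infinity. The identity theorem in small charts propagates this to all of \<open>\<real>\<^sup>2\<^sup>n\<close>.
\<close>

section \<open>Holomorphic functions along complex lines\<close>

definition complex_line :: "('a::euclidean_space \<Rightarrow>\<^sub>L 'a) \<Rightarrow> 'a \<Rightarrow> 'a \<Rightarrow> complex \<Rightarrow> 'a" where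
  "complex_line J0 a b \<zeta> = a + Re \<zeta> *\<^sub>R b + Im \<zeta> *\<^sub>R J0 b"

text \<open>A functional that is complex linear when \<open>J0\<close> acts as multiplication by \<open>\<i>\<close>.\<close>

definition complex_coord :: "('a::euclidean_space \<Rightarrow>\<^sub>L 'a) \<Rightarrow> 'a \<Rightarrow> 'a \<Rightarrow> complex" where
  "complex_coord J0 e v = Complex (e \<bullet> v) (- (e \<bullet> J0 v))"

lemma bounded_linear_complex_coord: "bounded_linear (complex_coord J0 e)"
  by (intro linear_conv_bounded_linear[THEN iffD1] linearI)
    (simp_all add: complex_coord_def complex_eq_iff inner_add_right algebra_simps blinfun.add_right blinfun.scaleR_right)

lemma complex_coord_J0:
  fixes J0 :: "'a::euclidean_space \<Rightarrow>\<^sub>L 'a"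
  assumes "\<And>v. J0 (J0 v) = - v"
  shows "complex_coord J0 e (x *\<^sub>R v + y *\<^sub>R J0 v) = Complex x y * complex_coord J0 e v"
  using assms by (simp add: complex_coord_def complex_eq_iff algebra_simps blinfun.add_right blinfun.scaleR_right)

lemma has_derivative_complex_line:
  "(complex_line J0 a b has_derivative (\<lambda>\<eta>. Re \<eta> *\<^sub>R b + Im \<eta> *\<^sub>R J0 b)) (at \<zeta>)"
  unfolding complex_line_def by (auto intro!: derivative_eq_intros)

lemma continuous_on_complex_line: "continuous_on S (complex_line J0 a b)"
  unfolding complex_line_def by (intro continuous_intros)

text \<open>Commuting with \<open>J0\<close> is the Cauchy-Riemann equation for \<open>F\<close>:
  along a complex line the real derivative becomes multiplication by a complex number. This is the
  bridge to one-variable function theory.\<close>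

lemma complex_coord_line_field_derivative:
  fixes J0 :: "'a::euclidean_space \<Rightarrow>\<^sub>L 'a"
  assumes J0: "\<And>v. J0 (J0 v) = - v"
    and F: "(F has_derivative F') (at (complex_line J0 a b \<zeta>))"
    and F': "\<And>v. F' (J0 v) = J0 (F' v)"
  shows "((\<lambda>\<zeta>. complex_coord J0 e (F (complex_line J0 a b \<zeta>)))
           has_field_derivative complex_coord J0 e (F' b)) (at \<zeta>)"
proof -
  interpret F': bounded_linear F' using F by (rule has_derivative_bounded_linear)
  have "((\<lambda>\<zeta>. complex_coord J0 e (F (complex_line J0 a b \<zeta>))) has_derivative
      (\<lambda>\<eta>. complex_coord J0 e (F' (Re \<eta> *\<^sub>R b + Im \<eta> *\<^sub>R J0 b)))) (at \<zeta>)"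
    by (intro bounded_linear.has_derivative[OF bounded_linear_complex_coord]
        has_derivative_compose[OF has_derivative_complex_line F])
  moreover have "complex_coord J0 e (F' (Re \<eta> *\<^sub>R b + Im \<eta> *\<^sub>R J0 b)) = complex_coord J0 e (F' b) * \<eta>" for \<eta>
    by (simp add: F'.add F'.scaleR F' complex_coord_J0[OF J0])
  ultimately show ?thesis by (simp add: has_field_derivative_def)
qed

section \<open>Inverting the twistor coordinate\<close>

text \<open>\<open>lipschitz\<close> is assumed besides \<open>near_id\<close> because
  \<open>U\<close> may fail to be convex, as for the exterior of a ball, where an infinitesimal
  bound does not integrate to a global one. The value 1/2 serves as contraction constant when
  \<open>W\<close> is inverted.\<close>

locale twistor_chart =
  fixes J0 :: "'a::euclidean_space \<Rightarrow>\<^sub>L 'a" and J N :: "'a \<Rightarrow> 'a \<Rightarrow>\<^sub>L 'a"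
    and N' :: "'a \<Rightarrow> 'a \<Rightarrow> 'a \<Rightarrow>\<^sub>L 'a" and U :: "'a set" and p :: 'a
  assumes J0_square: "J0 (J0 v) = - v"
    and open_U: "open U"
    and N_derivative: "x \<in> U \<Longrightarrow> (N has_derivative N' x) (at x)"
    and N_J: "x \<in> U \<Longrightarrow> N x (J x v) = J0 (N x v)"
    and N'_J: "x \<in> U \<Longrightarrow> N' x (J x v) u = J0 (N' x v u)"
    and lipschitz: "x \<in> U \<Longrightarrow> y \<in> U \<Longrightarrow>
      norm (N x (x - p) - N y (y - p) - (x - y)) \<le> norm (x - y) / 2"
    and near_id: "x \<in> U \<Longrightarrow> norm (N x v + N' x v (x - p) - v) \<le> norm v / 2"
begin

definition W :: "'a \<Rightarrow> 'a" where "W x = N x (x - p)"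

definition W' :: "'a \<Rightarrow> 'a \<Rightarrow> 'a" where "W' x v = N x v + N' x v (x - p)"

definition X :: "'a \<Rightarrow> 'a" where "X = inv_into U W"

lemma W_p: "W p = 0" by (simp add: W_def)

lemma W_derivative:
  assumes "x \<in> U" shows "(W has_derivative W' x) (at x)"
  unfolding W_def W'_def
  by (rule derivative_eq_intros N_derivative[OF assms] refl)+ simp

text \<open>Both summands of \<open>W'\<close> intertwine \<open>J\<close> with \<open>J0\<close>:
  \<open>N x\<close> as a linear map, and \<open>N' x\<close> in its direction argument because
  \<open>N\<close> itself is holomorphic.\<close>

lemma W'_J: "x \<in> U \<Longrightarrow> W' x (J x v) = J0 (W' x v)"
  by (simp add: W'_def N_J N'_J blinfun.add_right)

lemma W_expanding:
  assumes "x \<in> U" "y \<in> U" shows "norm (x - y) \<le> 2 * norm (W x - W y)"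
proof -
  have "norm (x - y) \<le> norm (W x - W y) + norm (W x - W y - (x - y))"
    by norm
  then show ?thesis using lipschitz[OF assms] by (simp add: W_def)
qed

lemma inj_W: "inj_on W U"
  by (rule inj_onI) (use W_expanding in fastforce)

lemma X_W: "x \<in> U \<Longrightarrow> X (W x) = x"
  by (simp add: X_def inj_W)

lemma X_in: "w \<in> W ` U \<Longrightarrow> X w \<in> U"
  by (simp add: X_def inv_into_into)

lemma W_X: "w \<in> W ` U \<Longrightarrow> W (X w) = w"
  by (simp add: X_def f_inv_into_f)

text \<open>Solutions are fixed points of \<open>f\<close>, which contracts by 1/2. The centre moves
  by at most \<open>s / 2\<close>, so \<open>f\<close> preserves the closed ball and Banach's
  theorem applies.\<close>

lemma W_solvable:
  assumes U: "cball c s \<subseteq> U" and w: "2 * norm (W c - w) \<le> s"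
  obtains x where "x \<in> cball c s" "W x = w"
proof -
  have s: "0 \<le> s" using w norm_ge_zero[of "W c - w"] by linarith
  define f where "f x = x - (W x - w)" for x
  have f: "norm (f x - f y) \<le> norm (x - y) / 2" if "x \<in> cball c s" "y \<in> cball c s" for x y
  proof -
    have "norm (f x - f y) = norm (W x - W y - (x - y))"
      by (subst norm_minus_commute) (simp add: f_def algebra_simps)
    moreover have "x \<in> U" "y \<in> U" using that U by auto
    ultimately show ?thesis using lipschitz[of x y] by (simp add: W_def)
  qed
  have "\<exists>!x. x \<in> cball c s \<and> f x = x"
  proof (rule Banach_fix[where c="1/2"])
    show "f ` cball c s \<subseteq> cball c s"
    proof clarify
      fix x assume x: "x \<in> cball c s"
      have "norm (f x - c) \<le> norm (f x - f c) + norm (W c - w)"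
        unfolding f_def by norm
      also have "\<dots> \<le> norm (x - c) / 2 + s / 2"
        using f[OF x, of c] s w by auto
      also have "\<dots> \<le> s" using x by (simp add: dist_norm norm_minus_commute)
      finally show "f x \<in> cball c s" by (simp add: dist_norm norm_minus_commute)
    qed
    show "dist (f x) (f y) \<le> 1/2 * dist x y" if "x \<in> cball c s" "y \<in> cball c s" for x y
      using f that by (simp add: dist_norm)
  qed (use s in \<open>auto simp: complete_eq_closed\<close>)
  then show ?thesis using that unfolding f_def by auto
qed

lemma open_image_W: "open (W ` U)"
proof (rule openI)
  fix w assume "w \<in> W ` U"
  then obtain x where x: "x \<in> U" "w = W x" by auto
  obtain s where s: "s > 0" "cball x s \<subseteq> U"
    using open_U x open_contains_cball by blast
  have "ball w (s/2) \<subseteq> W ` U"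
  proof
    fix y assume "y \<in> ball w (s/2)"
    then have "2 * norm (W x - y) \<le> s" by (simp add: x dist_norm)
    from W_solvable[OF s(2) this] s(2) show "y \<in> W ` U" by (metis image_eqI subsetD)
  qed
  then show "\<exists>e>0. ball w e \<subseteq> W ` U" using s by (intro exI[of _ "s/2"]) auto
qed

lemma continuous_on_X: "continuous_on (W ` U) X"
  unfolding continuous_on_iff
proof clarify
  fix x :: "'a" and e :: real assume x: "x \<in> U" "0 < e"
  show "\<exists>d>0. \<forall>x'\<in>W ` U. dist x' (W x) < d \<longrightarrow> dist (X x') (X (W x)) < e"
  proof (intro exI[of _ "e/2"] conjI ballI impI)
    fix w assume w: "w \<in> W ` U" "dist w (W x) < e / 2"
    then show "dist (X w) (X (W x)) < e"
      using W_expanding[OF X_in[OF w(1)] x(1)] by (simp add: X_W x W_X dist_norm)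
  qed (use x in auto)
qed

text \<open>By \<open>near_id\<close> the map \<open>W' (X w)\<close> is injective, hence
  invertible, and its inverse \<open>G\<close> is the derivative of \<open>X\<close>. Since
  \<open>G\<close> carries \<open>J0\<close> to \<open>J\<close> and \<open>N'\<close> carries
  \<open>J\<close> back to \<open>J0\<close>, the composite commutes with \<open>J0\<close>. The
  last property lets \<open>N'\<close> be recovered from \<open>F'\<close>.\<close>

lemma N_X_derivative:
  assumes w: "w \<in> W ` U"
  obtains F' where "((\<lambda>w. N (X w) u) has_derivative F') (at w)"
    "\<And>v. F' (J0 v) = J0 (F' v)" "\<And>v. F' (W' (X w) v) = N' (X w) v u"
proof -
  define x where "x = X w"
  have x: "x \<in> U" using X_in[OF w] by (simp add: x_def)
  have bl: "bounded_linear (W' x)" using W_derivative[OF x] by (rule has_derivative_bounded_linear)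
  interpret W': bounded_linear "W' x" by fact
  have "inj (W' x)"
    unfolding linear_injective_0[OF W'.linear]
  proof clarify
    fix v assume "W' x v = 0"
    then show "v = 0" using near_id[OF x, of v] by (simp add: W'_def)
  qed
  then obtain G where G: "linear G" "G \<circ> W' x = id" "W' x \<circ> G = id"
    using linear_injective_isomorphism[OF W'.linear] by (metis pointfree_idE comp_def eq_id_iff)
  have GW: "G (W' x v) = v" "W' x (G v) = v" for v
    using G by (metis comp_apply id_apply)+
  have X': "(X has_derivative G) (at w)"
  proof (rule has_derivative_inverse_basic[where f=W and T="W ` U"])
    show "(W has_derivative W' x) (at (X w))" using W_derivative[OF x] by (simp add: x_def)
    show "bounded_linear G" using G(1) by (simp add: linear_conv_bounded_linear)
    show "continuous (at w) X"
      using continuous_on_X open_image_W w continuous_on_eq_continuous_at by blast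
  qed (use G w open_image_W W_X in auto)
  have N': "(N has_derivative N' x) (at (X w))" using N_derivative[OF x] by (simp add: x_def)
  have "((\<lambda>w. N (X w) u) has_derivative (\<lambda>v. N' x (G v) u)) (at w)"
    by (rule derivative_eq_intros has_derivative_compose[OF X' N'] refl)+ simp
  moreover have "N' x (G (J0 v)) u = J0 (N' x (G v) u)" for v
  proof -
    have "G (J0 v) = J x (G v)"
      using GW W'_J[OF x, of "G v"] by metis
    then show ?thesis using N'_J[OF x] by simp
  qed
  ultimately show ?thesis using that[of "\<lambda>v. N' x (G v) u"] GW by (simp add: x_def)
qed

text \<open>Subtracting \<open>u\<close> leaves the derivative unchanged and makes the function
  vanish wherever \<open>N\<close> is the identity.\<close>

lemma holomorphic_slice:
  "(\<lambda>\<zeta>. complex_coord J0 e (N (X (complex_line J0 a b \<zeta>)) u - u))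
     holomorphic_on {\<zeta>. complex_line J0 a b \<zeta> \<in> W ` U}"
  unfolding holomorphic_on_def field_differentiable_def
proof (intro ballI)
  fix \<zeta> assume "\<zeta> \<in> {\<zeta>. complex_line J0 a b \<zeta> \<in> W ` U}"
  then obtain F' where F': "((\<lambda>w. N (X w) u) has_derivative F') (at (complex_line J0 a b \<zeta>))"
    "\<And>v. F' (J0 v) = J0 (F' v)" using N_X_derivative by blast
  have "((\<lambda>w. N (X w) u - u) has_derivative F') (at (complex_line J0 a b \<zeta>))"
    by (rule derivative_eq_intros F' refl)+ simp
  from complex_coord_line_field_derivative[OF J0_square this F'(2)]
  show "\<exists>f'. ((\<lambda>\<zeta>. complex_coord J0 e (N (X (complex_line J0 a b \<zeta>)) u - u)) has_field_derivative f')
    (at \<zeta> within {\<zeta>. complex_line J0 a b \<zeta> \<in> W ` U})"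
    by (meson has_field_derivative_at_within)
qed

end

section \<open>The affine coordinate of a structure near a constant one\<close>

text \<open>A total choice of inverse, so that inversion can be differentiated as a plain function;
  its value is unspecified when \<open>B\<close> is not invertible.\<close>

definition blinfun_inv :: "('a::euclidean_space \<Rightarrow>\<^sub>L 'a) \<Rightarrow> 'a \<Rightarrow>\<^sub>L 'a" where
  "blinfun_inv B = (SOME H :: 'a \<Rightarrow>\<^sub>L 'a. \<forall>v. H (B v) = v \<and> B (H v) = v)"

text \<open>A map bounded below is injective, and finite dimension makes it bijective.\<close>

lemma blinfun_inv:
  fixes B :: "'a::euclidean_space \<Rightarrow>\<^sub>L 'a"
  assumes c: "0 < c" "\<And>v. c * norm v \<le> norm (B v)"
  shows "blinfun_inv B (B v) = v" "B (blinfun_inv B v) = v" "norm (blinfun_inv B) \<le> 1 / c"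
proof -
  have "inj B"
    unfolding linear_injective_0[OF bounded_linear.linear[OF blinfun.bounded_linear_right]]
  proof (intro allI impI)
    fix v assume "B v = 0"
    then have "c * norm v \<le> 0" using c(2)[of v] by simp
    then show "v = 0" using c(1) by (simp add: mult_le_0_iff)
  qed
  then obtain G where G: "linear G" "G \<circ> B = id" "B \<circ> G = id"
    using linear_injective_isomorphism[OF bounded_linear.linear[OF blinfun.bounded_linear_right]] by (metis pointfree_idE comp_def eq_id_iff)
  then have "\<forall>v. Blinfun G (B v) = v \<and> B (Blinfun G v) = v"
    by (metis bounded_linear_Blinfun_apply comp_apply id_apply linear_conv_bounded_linear)
  then have inv: "\<forall>v. blinfun_inv B (B v) = v \<and> B (blinfun_inv B v) = v"
    unfolding blinfun_inv_def by (rule someI)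
  then show "blinfun_inv B (B v) = v" "B (blinfun_inv B v) = v" by auto
  show "norm (blinfun_inv B) \<le> 1 / c"
  proof (rule norm_blinfun_bound)
    show "norm (blinfun_inv B v) \<le> 1 / c * norm v" for v
      using c(2)[of "blinfun_inv B v"] c(1) inv by (simp add: field_simps)
  qed (use c in auto)
qed

lemma norm_compose3_le:
  "norm (A o\<^sub>L B o\<^sub>L C) \<le> norm A * norm B * norm C"
  by (meson norm_blinfun_compose norm_ge_zero mult_right_mono order_trans)

text \<open>Everything rests on the resolvent identity \<open>diff\<close>, used once to bound the
  increment of the inverse and once more to split off the linear part of that increment.\<close>

lemma has_derivative_blinfun_inv:
  fixes B :: "'b::real_normed_vector \<Rightarrow> 'a::euclidean_space \<Rightarrow>\<^sub>L 'a"
  assumes c: "0 < c" "\<And>y v. y \<in> U \<Longrightarrow> c * norm v \<le> norm (B y v)"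
    and U: "open U" "x \<in> U"
    and B': "(B has_derivative B') (at x)"
  shows "((\<lambda>y. blinfun_inv (B y)) has_derivative
           (\<lambda>v. - (blinfun_inv (B x) o\<^sub>L B' v o\<^sub>L blinfun_inv (B x)))) (at x)"
proof -
  let ?H = "\<lambda>y. blinfun_inv (B y)"
  note inv = blinfun_inv[OF c(1) c(2)]
  interpret B': bounded_linear B' using B' by (rule has_derivative_bounded_linear)
  obtain K where K: "0 < K" "\<And>v. norm (B' v) \<le> norm v * K"
    using B'.pos_bounded by blast
  obtain e where e: "e > 0" "ball x e \<subseteq> U" using U open_contains_ball by blast
  have diff: "?H y - ?H x = - (?H y o\<^sub>L (B y - B x) o\<^sub>L ?H x)" if "y \<in> U" for y
    using inv[OF that] inv[OF U(2)]
    by (intro blinfun_eqI) (simp add: blinfun.diff_left blinfun.diff_right blinfun.minus_left)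
  \<comment> \<open>\<open>r\<close> is the relative error of the linear approximation of
    \<open>B\<close>. In \<open>h\<close> it appears between two inverses, each of norm at most
    \<open>1 / c\<close>; the second term of \<open>h\<close> is the quadratic remainder, which
    involves three inverses.\<close>
  define r where "r y = norm (B y - B x - B' (y - x)) / norm (y - x)" for y
  define h where "h y = r y / c^2 + norm (B y - B x) * (r y + K) / c^3" for y
  show ?thesis
  proof (rule has_derivativeI_sandwich[where e = e and H = h])
    show "bounded_linear (\<lambda>v. - (?H x o\<^sub>L B' v o\<^sub>L ?H x))"
      by (intro bounded_linear_minus bounded_linear_compose[OF bounded_bilinear.bounded_linear_left[OF bounded_bilinear_blinfun_compose]]
          bounded_linear_compose[OF bounded_bilinear.bounded_linear_right[OF bounded_bilinear_blinfun_compose]] B'.bounded_linear_axioms)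
    have r: "(r \<longlongrightarrow> 0) (at x)"
      using B' unfolding has_derivative_iff_norm r_def by simp
    have "isCont B x" using B' by (rule has_derivative_continuous)
    then have "((\<lambda>y. norm (B y - B x)) \<longlongrightarrow> 0) (at x)"
      by (simp add: LIM_zero isCont_def tendsto_norm_zero)
    from tendsto_add[OF tendsto_divide[OF r tendsto_const] 
        tendsto_divide[OF tendsto_mult[OF this tendsto_add[OF r tendsto_const]] tendsto_const]]
    show "(h \<longlongrightarrow> 0) (at x)"
      unfolding h_def using c by auto
    fix y assume y: "y \<noteq> x" "dist y x < e"
    then have yU: "y \<in> U" using e by (auto simp: dist_commute)
    let ?n = "norm (y - x)"
    have n: "?n > 0" using y by simp
    have e1: "norm (B y - B x - B' (y - x)) = r y * ?n" using n by (simp add: r_def)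
    have "norm (B y - B x) \<le> norm (B y - B x - B' (y - x)) + norm (B' (y - x))"
      by norm
    then have e2: "norm (B y - B x) \<le> (r y + K) * ?n"
      using e1 K(2)[of "y - x"] by (simp add: algebra_simps)
    have Hx: "norm (?H x) \<le> 1 / c" "norm (?H y) \<le> 1/c" using inv(3)[OF U(2)] inv(3)[OF yU] .
    have "norm (?H y - ?H x) \<le> norm (?H y) * norm (B y - B x) * norm (?H x)"
      unfolding diff[OF yU] norm_minus_cancel by (rule norm_compose3_le)
    also have "\<dots> \<le> 1/c * norm (B y - B x) * (1/c)"
      using Hx c by (intro mult_mono mult_nonneg_nonneg) auto
    finally have e3: "norm (?H y - ?H x) \<le> norm (B y - B x) / c^2"
      by (simp add: power2_eq_square)
    have "?H y - ?H x - - (?H x o\<^sub>L B' (y - x) o\<^sub>L ?H x)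
        = - (?H x o\<^sub>L (B y - B x - B' (y - x)) o\<^sub>L ?H x) - ((?H y - ?H x) o\<^sub>L (B y - B x) o\<^sub>L ?H x)"
      using inv[OF yU] inv[OF U(2)]
      by (intro blinfun_eqI) (simp add: algebra_simps blinfun.add_left blinfun.add_right blinfun.diff_left blinfun.diff_right blinfun.minus_left)
    also have "norm \<dots> \<le> norm (?H x o\<^sub>L (B y - B x - B' (y - x)) o\<^sub>L ?H x)
        + norm ((?H y - ?H x) o\<^sub>L (B y - B x) o\<^sub>L ?H x)"
      by (metis norm_triangle_ineq4 norm_minus_cancel)
    also have "norm (?H x o\<^sub>L (B y - B x - B' (y - x)) o\<^sub>L ?H x)
        \<le> norm (?H x) * norm (B y - B x - B' (y - x)) * norm (?H x)" by (rule norm_compose3_le)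
    also have "\<dots> \<le> 1/c * (r y * ?n) * (1/c)"
      unfolding e1 using Hx c n by (intro mult_mono mult_nonneg_nonneg) (auto simp: r_def)
    also have "norm ((?H y - ?H x) o\<^sub>L (B y - B x) o\<^sub>L ?H x) 
       \<le> norm (?H y - ?H x) * norm (B y - B x) * norm (?H x)" by (rule norm_compose3_le)
    also have "\<dots> \<le> (norm (B y - B x) / c^2) * ((r y + K) * ?n) * (1/c)"
      using Hx e2 e3 c K(1) by (intro mult_mono mult_nonneg_nonneg add_nonneg_nonneg) (auto simp: r_def)
    finally have "norm (?H y - ?H x - - (?H x o\<^sub>L B' (y - x) o\<^sub>L ?H x)) \<le> h y * ?n"
      using c by (simp add: h_def field_simps power2_eq_square power3_eq_cube)
    then show "norm (?H y - ?H x - - (?H x o\<^sub>L B' (y - x) o\<^sub>L ?H x)) / norm (y - x) \<le> h y"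
      using n by (simp add: field_simps)
  qed (use e in auto)
qed

text \<open>\<open>J'_J\<close> stands in for integrability: it says that \<open>J\<close>, as a
  section of the twistor space, is holomorphic. \<open>J0\<close> is only a reference structure
  here; closeness to it is imposed through \<open>V\<close> or in the individual lemmas.\<close>

locale holomorphic_structure =
  fixes J0 :: "'a::euclidean_space \<Rightarrow>\<^sub>L 'a" and J :: "'a \<Rightarrow> 'a \<Rightarrow>\<^sub>L 'a"
    and J' :: "'a \<Rightarrow> 'a \<Rightarrow>\<^sub>L 'a \<Rightarrow>\<^sub>L 'a"
  assumes J0_square: "J0 (J0 v) = - v"
    and norm_J0: "norm (J0 v) = norm v"
    and J_square: "J x (J x v) = - v"
    and norm_J: "norm (J x v) = norm v"
    and J_derivative: "(J has_derivative J' x) (at x)"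
    and continuous_J': "continuous_on UNIV J'"
    and J'_J: "J' x (J x v) u = J x (J' x v u)"
begin

section \<open>The coordinate \<open>N\<close>, its derivative and its norm bounds\<close>

definition H :: "'a \<Rightarrow> 'a \<Rightarrow>\<^sub>L 'a" where "H x = blinfun_inv (J x + J0)"

text \<open>The factor in front normalises \<open>N\<close> to be the identity where
  \<open>J = J0\<close>.\<close>

definition N :: "'a \<Rightarrow> 'a \<Rightarrow>\<^sub>L 'a" where "N x = 2 *\<^sub>R (J0 o\<^sub>L H x)"

definition N' :: "'a \<Rightarrow> 'a \<Rightarrow> 'a \<Rightarrow>\<^sub>L 'a" where
  "N' x v = - 2 *\<^sub>R (J0 o\<^sub>L (H x o\<^sub>L J' x v o\<^sub>L H x))"

definition V :: "'a set" where "V = {x. norm (J x - J0) < 1/2}"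

lemma continuous_on_J: "continuous_on S J"
  using J_derivative by (meson continuous_at_imp_continuous_on has_derivative_continuous)

lemma open_V: "open V"
  unfolding V_def by (intro open_Collect_less continuous_intros continuous_on_J)

text \<open>\<open>J x + J0\<close> is twice the isometry \<open>J0\<close> plus a perturbation
  \<open>J x - J0\<close> of norm below 1/2.\<close>

lemma sum_lower_bound:
  assumes "x \<in> V" shows "3/2 * norm v \<le> norm ((J x + J0) v)"
proof -
  have "2 * norm v = norm ((J x + J0) v - (J x - J0) v)"
    by (simp add: blinfun.add_left blinfun.diff_left norm_J0 flip: scaleR_2)
  also have "\<dots> \<le> norm ((J x + J0) v) + norm (J x - J0) * norm v"
    by (meson add_left_mono norm_blinfun norm_triangle_ineq4 order_trans)
  also have "norm (J x - J0) * norm v \<le> 1/2 * norm v"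
    using assms by (intro mult_right_mono) (auto simp: V_def)
  finally show ?thesis by simp
qed

lemma H:
  assumes "x \<in> V"
  shows "H x ((J x + J0) v) = v" "(J x + J0) (H x v) = v" "norm (H x) \<le> 2/3"
  using blinfun_inv[of "3/2" "J x + J0"] sum_lower_bound[OF assms] by (auto simp: H_def)

lemma norm_sum: "norm (J x + J0) \<le> 2"
proof (rule norm_blinfun_bound)
  show "norm ((J x + J0) v) \<le> 2 * norm v" for v
    using norm_triangle_ineq[of "J x v" "J0 v"] by (simp add: blinfun.add_left norm_J norm_J0)
qed simp

lemma H_derivative:
  assumes "x \<in> V"
  shows "(H has_derivative (\<lambda>v. - (H x o\<^sub>L J' x v o\<^sub>L H x))) (at x)"
proof -
  have "((\<lambda>x. J x + J0) has_derivative J' x) (at x)"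
    by (rule derivative_eq_intros J_derivative refl)+ simp
  from has_derivative_blinfun_inv[OF _ sum_lower_bound open_V assms this]
  show ?thesis unfolding H_def[abs_def] by simp
qed

lemma N_derivative: "x \<in> V \<Longrightarrow> (N has_derivative N' x) (at x)"
  unfolding N_def N'_def
  by (rule derivative_eq_intros H_derivative bounded_linear.has_derivative[OF bounded_bilinear.bounded_linear_right[OF bounded_bilinear_blinfun_compose]] | assumption | simp)+
    (auto simp: fun_eq_iff blinfun_eqI blinfun.minus_left blinfun.minus_right blinfun.scaleR_left)

text \<open>With both squares equal to minus the identity, \<open>J (J + J0)\<close> and
  \<open>(J + J0) J0\<close> are both \<open>J J0 - 1\<close>; inverting the sum turns this into the
  intertwining relation.\<close>

lemma H_J:
  assumes "x \<in> V" shows "H x (J x v) = J0 (H x v)"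
proof -
  have "J x v = J x ((J x + J0) (H x v))" by (simp add: H(2)[OF assms])
  also have "\<dots> = (J x + J0) (J0 (H x v))"
    by (simp add: blinfun.add_left blinfun.add_right J_square J0_square)
  finally show ?thesis by (simp add: H(1)[OF assms])
qed

lemma N_J: "x \<in> V \<Longrightarrow> N x (J x v) = J0 (N x v)"
  by (simp add: N_def H_J blinfun.scaleR_left blinfun.scaleR_right)

lemma N'_J: "x \<in> V \<Longrightarrow> N' x (J x v) u = J0 (N' x v u)"
  by (simp add: N'_def J'_J H_J blinfun.scaleR_left blinfun.scaleR_right blinfun.minus_left blinfun.minus_right)

text \<open>Writing the identity as \<open>(J + J0) H\<close> gives
  \<open>N - 1 = (J0 - J) H\<close>, and \<open>H\<close> has norm at most 2/3.\<close>

lemma N_near_1: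
  assumes "x \<in> V" shows "norm (N x - id_blinfun) \<le> norm (J x - J0)"
proof -
  have "N x - id_blinfun = (J0 - J x) o\<^sub>L H x"
  proof (rule blinfun_eqI)
    fix v
    have "v = J x (H x v) + J0 (H x v)" using H(2)[OF assms, of v] by (simp add: blinfun.add_left)
    then show "(N x - id_blinfun) v = ((J0 - J x) o\<^sub>L H x) v"
      by (simp add: N_def blinfun.diff_left blinfun.add_left scaleR_2 algebra_simps)
  qed
  also have "norm \<dots> \<le> norm (J0 - J x) * norm (H x)" by (rule norm_blinfun_compose)
  also have "\<dots> \<le> norm (J0 - J x) * 1" using H(3)[OF assms] by (intro mult_left_mono) auto
  finally show ?thesis by (simp add: norm_minus_commute)
qed

lemma N_near_1_apply:
  assumes "x \<in> V" shows "norm (N x v - v) \<le> norm (J x - J0) * norm v"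
  using norm_blinfun[of "N x - id_blinfun" v] mult_right_mono[OF N_near_1[OF assms], of "norm v"]
  by (simp add: blinfun.diff_left)

lemma norm_N'_le:
  assumes "x \<in> V" shows "norm (N' x v u) \<le> norm (J' x) * norm v * norm u"
proof -
  have h: "norm (H x w) \<le> 2/3 * norm w" for w
    using H(3)[OF assms] by (meson mult_right_mono norm_blinfun norm_ge_zero order_trans)
  have "norm (N' x v u) = 2 * norm (H x (J' x v (H x u)))"
    by (simp add: N'_def blinfun.scaleR_left norm_J0 blinfun.minus_left)
  also have "\<dots> \<le> 2 * (2/3 * norm (J' x v (H x u)))" using h by (intro mult_left_mono) auto
  also have "norm (J' x v (H x u)) \<le> norm (J' x v) * norm (H x u)" by (rule norm_blinfun)
  also have "\<dots> \<le> (norm (J' x) * norm v) * (2/3 * norm u)"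
    using h norm_blinfun by (intro mult_mono mult_nonneg_nonneg) auto
  finally have "norm (N' x v u) \<le> 8/9 * (norm (J' x) * norm v * norm u)" by simp
  moreover have "0 \<le> norm (J' x) * norm v * norm u" by simp
  ultimately show ?thesis by linarith
qed

text \<open>The formula for \<open>N'\<close> is solved for \<open>J'\<close> by feeding it
  \<open>J x + J0\<close> and cancelling the outer \<open>H\<close>. Two factors
  \<open>J x + J0\<close> of norm at most 2 and the factor 2 in \<open>N'\<close> leave the constant
  2.\<close>

lemma norm_J'_le:
  assumes x: "x \<in> V" and c: "0 \<le> c" "\<And>v u. norm (N' x v u) \<le> c * norm v * norm u"
  shows "norm (J' x) \<le> 2 * c"
proof (rule norm_blinfun_bound)
  fix v
  show "norm (J' x v) \<le> 2 * c * norm v"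
  proof (rule norm_blinfun_bound)
    fix u
    let ?B = "J x + J0"
    have B: "norm (?B w) \<le> 2 * norm w" for w
      using norm_sum by (meson mult_right_mono norm_blinfun norm_ge_zero order_trans)
    have "N' x v (?B u) = - 2 *\<^sub>R J0 (H x (J' x v u))"
      by (simp add: N'_def H(1)[OF x] blinfun.scaleR_left blinfun.minus_left)
    then have "norm (H x (J' x v u)) = norm (N' x v (?B u)) / 2" by (simp add: norm_J0)
    moreover have "J' x v u = ?B (H x (J' x v u))" by (simp add: H(2)[OF x])
    then have "norm (J' x v u) \<le> 2 * norm (H x (J' x v u))" using B by metis
    ultimately have "norm (J' x v u) \<le> norm (N' x v (?B u))" by simp
    also have "\<dots> \<le> c * norm v * norm (?B u)" by (rule c)
    also have "\<dots> \<le> c * norm v * (2 * norm u)" using c B by (intro mult_left_mono) auto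
    finally show "norm (J' x v u) \<le> 2 * c * norm v * norm u" by simp
  qed (use c in auto)
qed (use c in auto)

lemma J_eq_J0:
  assumes "x \<in> V" "N x = id_blinfun" shows "J x = J0"
  using N_J[OF assms(1)] assms(2) by (intro blinfun_eqI) simp

lemma N_eq_id:
  assumes "J x = J0" shows "N x = id_blinfun"
proof -
  have "x \<in> V" using assms by (simp add: V_def)
  from N_near_1[OF this] assms show ?thesis by simp
qed

subsection \<open>Charts and the gradient estimate\<close>

lemma J0_inner: "J0 v \<bullet> w = - (v \<bullet> J0 w)"
proof -
  have pol: "J0 a \<bullet> J0 b = a \<bullet> b" for a b
    using norm_J0[of "a + b"] norm_J0[of a] norm_J0[of b]
    by (simp add: dot_norm blinfun.add_right)
  show ?thesis using pol[of v "J0 w"] by (simp add: J0_square)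
qed

lemma inner_J0_self: "v \<bullet> J0 v = 0"
  using J0_inner[of v v] by (simp add: inner_commute)

text \<open>The hypotheses make \<open>a\<close> orthogonal to both \<open>b\<close> and
  \<open>J0 b\<close>, so Pythagoras applies and \<open>a\<close> is a point of the line closest to
  the origin.\<close>

lemma norm_complex_line_sq:
  assumes "a \<bullet> b = 0" "J0 a \<bullet> b = 0"
  shows "(norm (complex_line J0 a b \<zeta>))\<^sup>2 = (norm a)\<^sup>2 + (cmod \<zeta> * norm b)\<^sup>2"
proof -
  have ab: "a \<bullet> J0 b = 0" "b \<bullet> a = 0" "J0 b \<bullet> a = 0" "J0 b \<bullet> J0 b = b \<bullet> b" "b \<bullet> J0 b = 0" "J0 b \<bullet> b = 0"
    using assms J0_inner[of a b] inner_J0_self[of b] norm_J0[of b]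
    by (simp_all add: inner_commute dot_square_norm)
  show ?thesis
    unfolding power_mult_distrib cmod_power2 power2_norm_eq_inner[where 'a='a]
    using assms by (simp add: complex_line_def inner_add_left inner_add_right ab algebra_simps power2_eq_square)
qed

lemma cmod_complex_coord_le: "cmod (complex_coord J0 e v) \<le> 2 * norm e * norm v"
proof -
  have "cmod (complex_coord J0 e v) \<le> \<bar>e \<bullet> v\<bar> + \<bar>e \<bullet> J0 v\<bar>"
    unfolding complex_coord_def by (rule order_trans[OF cmod_le]) simp
  also have "\<dots> \<le> norm e * norm v + norm e * norm (J0 v)"
    by (intro add_mono Cauchy_Schwarz_ineq2)
  finally show ?thesis by (simp add: norm_J0)
qed

text \<open>Testing a vector with its own functional recovers its norm, so scalar estimates and
  vanishing results transfer to vectors.\<close>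

lemma complex_coord_self: "complex_coord J0 v v = of_real ((norm v)\<^sup>2)"
  by (simp add: complex_coord_def complex_eq_iff inner_J0_self power2_norm_eq_inner)

section \<open>Perturbation bounds for \<open>W\<close> and charts on balls\<close>

lemma near_id_bound:
  assumes "x \<in> V"
  shows "norm (N x v + N' x v (x - p) - v) \<le> (norm (J x - J0) + norm (J' x) * norm (x - p)) * norm v"
proof -
  have "norm (N x v + N' x v (x - p) - v) \<le> norm (N x v - v) + norm (N' x v (x - p))"
    by norm
  also have "norm (N x v - v) \<le> norm (J x - J0) * norm v" by (rule N_near_1_apply[OF assms])
  also have "norm (N' x v (x - p)) \<le> norm (J' x) * norm v * norm (x - p)"
    by (rule norm_N'_le[OF assms])
  finally show ?thesis by (simp add: algebra_simps)
qed

text \<open>The mean value inequality for \<open>W\<close> minus the identity, whose derivative is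
  controlled by \<open>near_id_bound\<close>.\<close>

lemma lipschitz_on_convex:
  assumes S: "convex S" "S \<subseteq> V" and k: "0 \<le> k"
    and bound: "\<And>x. x \<in> S \<Longrightarrow> norm (J x - J0) + norm (J' x) * norm (x - p) \<le> k"
    and xy: "x \<in> S" "y \<in> S"
  shows "norm (N x (x - p) - N y (y - p) - (x - y)) \<le> k * norm (x - y)"
proof -
  have "norm ((N x (x - p) - x) - (N y (y - p) - y)) \<le> k * norm (x - y)"
  proof (rule differentiable_bound[OF S(1) _ _ xy, where f = "\<lambda>x. N x (x - p) - x"])
    fix z assume z: "z \<in> S"
    then have zV: "z \<in> V" using S by auto
    show "((\<lambda>x. N x (x - p) - x) has_derivative (\<lambda>v. N z v + N' z v (z - p) - v)) (at z within S)"
      by (rule derivative_eq_intros has_derivative_at_withinI[OF N_derivative[OF zV]] refl)+ simp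
    show "onorm (\<lambda>v. N z v + N' z v (z - p) - v) \<le> k"
    proof (rule onorm_bound[OF k])
      fix v
      show "norm (N z v + N' z v (z - p) - v) \<le> k * norm v"
        using near_id_bound[OF zV, of v p] bound[OF z]
        by (meson mult_right_mono norm_ge_zero order_trans)
    qed
  qed
  then show ?thesis by (simp add: algebra_simps)
qed

lemma ball_chart:
  assumes "\<And>x. x \<in> ball p r \<Longrightarrow> norm (J x - J0) \<le> 1/4"
    and "\<And>x. x \<in> ball p r \<Longrightarrow> r * norm (J' x) \<le> 1/4"
  shows "twistor_chart J0 J N N' (ball p r) p"
proof -
  have sub: "ball p r \<subseteq> V" using assms(1) by (force simp: V_def)
  have b: "norm (J x - J0) + norm (J' x) * norm (x - p) \<le> 1/2" if x: "x \<in> ball p r" for x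
  proof -
    have "norm (J' x) * norm (x - p) \<le> norm (J' x) * r"
      using x by (intro mult_left_mono) (auto simp: dist_norm norm_minus_commute)
    then show ?thesis using assms[OF x] by (simp add: mult.commute)
  qed
  show ?thesis
  proof
    fix x y v assume "x \<in> ball p r" "y \<in> ball p r"
    from lipschitz_on_convex[OF convex_ball sub _ b this]
    show "norm (N x (x - p) - N y (y - p) - (x - y)) \<le> norm (x - y) / 2" by simp
  next
    fix x v assume x: "x \<in> ball p r"
    then have "x \<in> V" using sub by auto
    from order_trans[OF near_id_bound[OF this, of v p] mult_right_mono[OF b[OF x], of "norm v"]]
    show "norm (N x v + N' x v (x - p) - v) \<le> norm v / 2" by simp
  qed (use sub N_derivative N_J N'_J J0_square in auto)
qed

text \<open>Since \<open>W p = 0\<close>, the equation \<open>W x = w\<close> is solvable within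
  distance \<open>2 * norm w\<close> of \<open>p\<close>.\<close>

lemma ball_subset_chart:
  assumes "twistor_chart J0 J N N' (ball p r) p"
  shows "ball 0 (r/2) \<subseteq> twistor_chart.W N p ` ball p r"
proof
  interpret twistor_chart J0 J N N' "ball p r" p by fact
  fix w :: 'a assume w: "w \<in> ball 0 (r/2)"
  have "cball p (2 * norm w) \<subseteq> ball p r" using w by auto
  from W_solvable[OF this, of w] this show "w \<in> W ` ball p r"
    by (metis W_p diff_0 norm_minus_cancel order_refl rev_image_eqI subsetD)
qed

text \<open>In the chart, \<open>N\<close> composed with the inverse of \<open>W\<close> is
  holomorphic and within about \<epsilon> of the identity, so Cauchy's inequality on a complex line
  through \<open>W p = 0\<close> bounds its derivative there.\<close>

lemma derivative_bound_chart:
  assumes r: "0 < r" and eps: "\<epsilon> \<le> 1/4"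
    and near: "\<And>x. x \<in> ball p r \<Longrightarrow> norm (J x - J0) \<le> \<epsilon>"
    and J': "\<And>x. x \<in> ball p r \<Longrightarrow> r * norm (J' x) \<le> 1/4"
  shows "r * norm (J' p) \<le> 40 * \<epsilon>"
proof -
  have chart: "twistor_chart J0 J N N' (ball p r) p"
    using near eps J' by (intro ball_chart) force+
  interpret twistor_chart J0 J N N' "ball p r" p by (rule chart)
  have U: "ball p r \<subseteq> V" using near eps by (force simp: V_def)
  have p: "p \<in> ball p r" "p \<in> V" using r U by auto
  have e0: "0 \<le> \<epsilon>" using near[OF p(1)] norm_ge_zero order_trans by blast
  have sub: "ball 0 (r/2) \<subseteq> W ` ball p r" by (rule ball_subset_chart[OF chart])
  have main: "norm (N' p v u) \<le> 20 * \<epsilon> / r * norm v * norm u" for v u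
  proof -
    \<comment> \<open>\<open>b\<close> equals \<open>W' p v\<close>, because the second term of
      \<open>W'\<close> vanishes at \<open>p\<close>; hence the derivative of the slice in direction
      \<open>b\<close> is \<open>d\<close>. Using \<open>d\<close> also as test vector turns that
      derivative into the squared norm of \<open>d\<close>.\<close>
    define b where "b = N p v"
    define d where "d = N' p v u"
    have X0: "X 0 = p" using X_W[OF p(1)] by (simp add: W_p)
    have "0 \<in> W ` ball p r" using sub r by auto
    then obtain F' where F': "((\<lambda>w. N (X w) u) has_derivative F') (at 0)"
      "\<And>v. F' (J0 v) = J0 (F' v)" "\<And>v. F' (W' p v) = N' p v u"
      using N_X_derivative X0 by metis
    have F'b: "F' b = d" using F'(3)[of v] by (simp add: W'_def b_def d_def)
    interpret F': bounded_linear F' using F'(1) by (rule has_derivative_bounded_linear)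
    have "norm b \<le> norm v + norm (N p v - v)"
      unfolding b_def by norm
    also have "norm (N p v - v) \<le> 1/4 * norm v"
      using N_near_1_apply[OF p(2)] near[OF p(1)] eps
      by (meson mult_right_mono norm_ge_zero order_trans)
    finally have b: "norm b \<le> 5/4 * norm v" by simp
    show ?thesis
    proof (cases "b = 0 \<or> d = 0")
      case True
      then show ?thesis using F'b F'.zero e0 r by (auto simp: d_def)
    next
      case False
      \<comment> \<open>The radius keeps the slice inside the chart image \<open>ball 0 (r/2)\<close>.\<close>
      define s where "s = r / (8 * norm b)"
      have s: "s > 0" using False r by (simp add: s_def)
      define h where "h \<zeta> = complex_coord J0 d (N (X (complex_line J0 0 b \<zeta>)) u - u)" for \<zeta>
      have line: "complex_line J0 0 b \<zeta> \<in> ball 0 (r/2)" if "\<zeta> \<in> cball 0 s" for \<zeta>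
      proof -
        have "(norm (complex_line J0 0 b \<zeta>))\<^sup>2 = (cmod \<zeta> * norm b)\<^sup>2"
          by (subst norm_complex_line_sq) auto
        then have "norm (complex_line J0 0 b \<zeta>) = cmod \<zeta> * norm b"
          by (simp add: power2_eq_iff_nonneg)
        also have "\<dots> \<le> s * norm b" using that by (intro mult_right_mono) auto
        also have "\<dots> < r / 2" using r False by (simp add: s_def)
        finally show ?thesis by simp
      qed
      have hol: "h holomorphic_on cball 0 s"
        unfolding h_def
        by (rule holomorphic_on_subset[OF holomorphic_slice]) (use line sub in auto)
      have hb: "norm (h \<zeta>) \<le> 2 * norm d * \<epsilon> * norm u" if "\<zeta> \<in> cball 0 s" for \<zeta>
      proof -
        let ?x = "X (complex_line J0 0 b \<zeta>)"
        have x: "?x \<in> ball p r" using X_in sub line[OF that] by auto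
        have "norm (N ?x u - u) \<le> norm (J ?x - J0) * norm u"
          using N_near_1_apply x U by blast
        also have "\<dots> \<le> \<epsilon> * norm u"
          using near[OF x] by (intro mult_right_mono) auto
        finally have "2 * norm d * norm (N ?x u - u) \<le> 2 * norm d * (\<epsilon> * norm u)"
          by (intro mult_left_mono) auto
        then show ?thesis
          using cmod_complex_coord_le[of d "N ?x u - u"] unfolding h_def by (simp add: mult.assoc)
      qed
      have "norm ((deriv ^^ 1) h 0) \<le> fact 1 * (2 * norm d * \<epsilon> * norm u) / s ^ 1"
        using hol s hb
        by (intro Cauchy_inequality) (auto intro: holomorphic_on_subset holomorphic_on_imp_continuous_on)
      moreover have "(h has_field_derivative complex_coord J0 d (F' b)) (at 0)"
        unfolding h_def
      proof (rule complex_coord_line_field_derivative[where F' = F', OF J0_square])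
        show "((\<lambda>w. N (X w) u - u) has_derivative F') (at (complex_line J0 0 b 0))"
          using has_derivative_diff[OF F'(1) has_derivative_const[of u]] by (simp add: complex_line_def)
      qed (rule F'(2))
      then have "deriv h 0 = of_real ((norm d)\<^sup>2)"
        by (simp add: DERIV_imp_deriv F'b complex_coord_self)
      ultimately have "(norm d)\<^sup>2 \<le> 2 * norm d * \<epsilon> * norm u / s"
        by (simp add: norm_power)
      then have "norm d * norm d \<le> norm d * (2 * \<epsilon> * norm u / s)"
        by (simp add: power2_eq_square mult_ac)
      then have "norm d \<le> 2 * \<epsilon> * norm u / s" using False
        by (metis mult_le_cancel_left_pos zero_less_norm_iff)
      also have "\<dots> = 16 * \<epsilon> * norm u / r * norm b" using False r by (simp add: s_def)
      also have "\<dots> \<le> 16 * \<epsilon> * norm u / r * (5/4 * norm v)"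
        using b e0 r by (intro mult_left_mono) auto
      finally show ?thesis by (simp add: d_def mult_ac)
    qed
  qed
  have "norm (J' p) \<le> 2 * (20 * \<epsilon> / r)"
    using main e0 r by (intro norm_J'_le[OF p(2)]) auto
  then show ?thesis using r by (simp add: field_simps)
qed

text \<open>Heinz-type scaling: at the maximum of \<open>(\<rho> - dist a x) |DJ x|\<close> the derivative is controlled, up to a
  factor \<open>2\<close>, on a ball of comparable radius, where \<open>derivative_bound_chart\<close> applies.\<close>

lemma derivative_bound:
  assumes \<rho>: "0 < \<rho>" and eps: "\<epsilon> \<le> 1/1000"
    and near: "\<And>x. x \<in> cball a \<rho> \<Longrightarrow> norm (J x - J0) \<le> \<epsilon>"
  shows "\<rho> * norm (J' a) \<le> 160 * \<epsilon>"
proof -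
  let ?\<phi> = "\<lambda>x. (\<rho> - dist a x) * norm (J' x)"
  have "continuous_on (cball a \<rho>) ?\<phi>"
    by (intro continuous_intros continuous_on_subset[OF continuous_J']) auto
  then obtain y where y: "y \<in> cball a \<rho>" "\<And>x. x \<in> cball a \<rho> \<Longrightarrow> ?\<phi> x \<le> ?\<phi> y"
    using continuous_attains_sup[of "cball a \<rho>" ?\<phi>] \<rho> by auto
  define M d where "M = ?\<phi> y" and "d = \<rho> - dist a y"
  have e0: "0 \<le> \<epsilon>" using near[of a] \<rho> norm_ge_zero[of "J a - J0"] by (simp del: norm_ge_zero)
  have "\<rho> * norm (J' a) \<le> M" using y(2)[of a] \<rho> by (simp add: M_def)
  moreover have "M \<le> 160 * \<epsilon>"
  proof (cases "d = 0")
    case True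
    then show ?thesis using e0 by (simp add: M_def d_def)
  next
    case False
    then have d: "d > 0" using y(1) by (simp add: d_def)
    have M: "M = d * norm (J' y)" "0 \<le> M" using d by (auto simp: M_def d_def)
    \<comment> \<open>On \<open>ball y r\<close> maximality gives
      \<open>norm (J' x) \<le> 2 * M / d\<close>. The summand 2 keeps \<open>r\<close> below
      \<open>d / 2\<close>, and \<open>8 * M\<close> forces \<open>r * norm (J' x)\<close> below
      1/4.\<close>
    define r where "r = d / (2 + 8 * M)"
    have "2 + 8 * M > 0" using M(2) by simp
    then have r: "r > 0" "r \<le> d / 2" "r * (2 + 8 * M) = d"
      using d M(2) by (auto simp: r_def field_simps simp del: distrib_left_numeral)
    have "r * norm (J' y) \<le> 40 * \<epsilon>"
    proof (rule derivative_bound_chart[OF r(1)])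
      fix x assume x: "x \<in> ball y r"
      have "dist a x \<le> dist a y + dist y x" by (rule dist_triangle)
      then have dx: "d / 2 \<le> \<rho> - dist a x" using x r by (simp add: d_def)
      then have xa: "x \<in> cball a \<rho>" using d by simp
      then show "norm (J x - J0) \<le> \<epsilon>" by (rule near)
      have "d / 2 * norm (J' x) \<le> M"
        using y(2)[OF xa] dx by (metis M_def mult_right_mono norm_ge_zero order_trans)
      moreover have "(2 + 8 * M) * (r * norm (J' x)) = d * norm (J' x)"
        using r(3) by (metis mult.assoc mult.commute)
      ultimately have "(2 + 8 * M) * (r * norm (J' x)) \<le> 2 * M" by linarith
      also have "\<dots> \<le> (2 + 8 * M) * (1/4)" by simp
      finally show "r * norm (J' x) \<le> 1/4" using M(2) by simp
    qed (use eps in simp)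
    then have "(2 + 8 * M) * (r * norm (J' y)) \<le> (2 + 8 * M) * (40 * \<epsilon>)"
      using M(2) by (intro mult_left_mono) auto
    moreover have "(2 + 8 * M) * (r * norm (J' y)) = M"
      unfolding M(1) using r(3) by (metis M(1) mult.assoc mult.commute)
    ultimately have "M \<le> 80 * \<epsilon> + 320 * \<epsilon> * M" by (simp add: algebra_simps)
    \<comment> \<open>The smallness of \<epsilon> allows this term to be absorbed into the left-hand
      side.\<close>
    also have "320 * \<epsilon> * M \<le> 1/2 * M" using eps M(2) by (intro mult_right_mono) auto
    finally show ?thesis by simp
  qed
  ultimately show ?thesis by linarith
qed

subsection \<open>Rigidity near infinity and unique continuation\<close>

text \<open>The gradient estimate on the ball of radius \<open>norm x / 2\<close> around
  \<open>x\<close> bounds \<open>norm x * norm (J' x)\<close> by 0.32. The factor 4 pays for two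
  halvings: one for this ball, one for the convex ball used to compare nearby points.\<close>

lemma exterior_chart:
  assumes R: "0 < R" and near: "\<And>x. R \<le> norm x \<Longrightarrow> norm (J x - J0) \<le> 1/1000"
  shows "twistor_chart J0 J N N' {x. 4 * R < norm x} 0"
proof -
  have V: "x \<in> V" if "R \<le> norm x" for x using near[OF that] by (simp add: V_def)
  have b: "norm (J x - J0) + norm (J' x) * norm (x - 0) \<le> 1/2" if x: "2 * R \<le> norm x" for x
  proof -
    have "norm x / 2 * norm (J' x) \<le> 160 * (1/1000)"
    proof (rule derivative_bound)
      fix y assume "y \<in> cball x (norm x / 2)"
      then have "norm x \<le> norm y + norm x / 2"
        using norm_triangle_sub[of x y] by (simp add: dist_norm)
      then show "norm (J y - J0) \<le> 1/1000" using x by (intro near) simp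
    qed (use x R in auto)
    then have "norm (J' x) * norm x \<le> 320/1000" by (simp add: field_simps)
    moreover have "norm (J x - J0) \<le> 1/1000" using x R by (intro near) auto
    ultimately show ?thesis by simp
  qed
  show ?thesis
  proof
    show "open {x::'a. 4 * R < norm x}" by (intro open_Collect_less continuous_intros)
    fix x y :: 'a and v u :: 'a
    assume x': "x \<in> {x. 4 * R < norm x}"
    then have x: "4 * R < norm x" by simp
    then have xV: "x \<in> V" using R by (intro V) simp
    then show "(N has_derivative N' x) (at x)" "N x (J x v) = J0 (N x v)" "N' x (J x v) u = J0 (N' x v u)"
      by (simp_all add: N_derivative N_J N'_J)
    show "norm (N x v + N' x v (x - 0) - v) \<le> norm v / 2"
      using order_trans[OF near_id_bound[OF xV, of v 0] mult_right_mono[OF b, of x "norm v"]] x R by simp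
    assume "y \<in> {x. 4 * R < norm x}"
    then have y: "4 * R < norm y" by simp
    then have yV: "y \<in> V" using R by (intro V) simp
    show "norm (N x (x - 0) - N y (y - 0) - (x - y)) \<le> norm (x - y) / 2"
    \<comment> \<open>The exterior domain is not convex: nearby points are joined by a segment, for distant ones
        the smallness of \<open>N - 1\<close> is enough.\<close>
    proof (cases "norm (x - y) \<le> norm x / 2")
      case True
      have far: "2 * R \<le> norm z" if "z \<in> cball x (norm x / 2)" for z
      proof -
        have "norm x \<le> norm z + norm x / 2"
          using that norm_triangle_sub[of x z] by (simp add: dist_norm)
        then show ?thesis using x by simp
      qed
      have "cball x (norm x / 2) \<subseteq> V" using far V R by force
      from lipschitz_on_convex[OF convex_cball this _ b, where x = x and y = y] far True
      show ?thesis by (simp add: dist_norm)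
    next
      case False
      have W: "norm (N z z - z) \<le> 1/1000 * norm z" if "R \<le> norm z" for z
        using N_near_1_apply[OF V[OF that]] near[OF that]
        by (meson mult_right_mono norm_ge_zero order_trans)
      have "norm (N x x - N y y - (x - y)) \<le> norm (N x x - x) + norm (N y y - y)"
        by norm
      also have "\<dots> \<le> 1/1000 * norm x + 1/1000 * norm y"
        using W[of x] W[of y] x y R by simp
      \<comment> \<open>Here \<open>norm x\<close> is below twice, and \<open>norm y\<close> below
        three times, the distance of the points.\<close>
      also have "\<dots> \<le> norm (x - y) / 2"
        using False norm_triangle_sub[of y x] norm_ge_zero[of "x - y"]
        by (simp add: norm_minus_commute del: norm_ge_zero)
      finally show ?thesis by simp
    qed
  qed (rule J0_square)
qed

text \<open>Supplies the direction of a complex line through \<open>a\<close> that comes no closer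
  to the origin than \<open>a\<close>. The dimension bound leaves room beside the real span of
  \<open>a\<close> and \<open>J0 a\<close>.\<close>

lemma far_line_exists:
  assumes "3 \<le> DIM('a)"
  obtains b where "b \<noteq> 0" "a \<bullet> b = 0" "J0 a \<bullet> b = 0"
proof -
  have "dim {a, J0 a} \<le> card {a, J0 a}" by (intro dim_le_card') auto
  also have "\<dots> \<le> 2" by (simp add: card_insert_if)
  finally have "dim (span {a, J0 a}) < DIM('a)" using assms by simp
  then obtain b where "b \<noteq> 0" "\<And>y. y \<in> span {a, J0 a} \<Longrightarrow> orthogonal b y"
    using orthogonal_to_subspace_exists by (metis dim_span)
  then have "b \<noteq> 0" "orthogonal b a" "orthogonal b (J0 a)" by (auto intro: span_base)
  then show ?thesis using that[of b] by (simp add: orthogonal_def inner_commute)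
qed

text \<open>Each far point \<open>a\<close> lies on a complex line inside the image of the exterior
  chart. The slices of \<open>N\<close> are entire there and decay at infinity, so Liouville makes
  them zero.\<close>

lemma eventually_J0_dim_ge_3:
  assumes dim: "3 \<le> DIM('a)"
    and lim: "((\<lambda>x. norm (J x - J0)) \<longlongrightarrow> 0) at_infinity"
  obtains R where "0 < R" "\<And>x. R < norm x \<Longrightarrow> J x = J0"
proof -
  obtain R0 where R0: "\<And>x. R0 \<le> norm x \<Longrightarrow> norm (J x - J0) < 1/1000"
    using lim[unfolded Lim_at_infinity, rule_format, of "1/1000"] by auto
  define R where "R = max 1 R0"
  have R: "0 < R" by (simp add: R_def)
  have near: "norm (J x - J0) \<le> 1/1000" if "R \<le> norm x" for x
    using R0[of x] that by (simp add: R_def)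
  let ?U = "{x::'a. 4 * R < norm x}"
  have chart: "twistor_chart J0 J N N' ?U 0" by (rule exterior_chart[OF R near])
  interpret twistor_chart J0 J N N' ?U 0 by (rule chart)
  have V: "x \<in> V" if "R \<le> norm x" for x using near[OF that] by (simp add: V_def)
  have W_near: "norm (W x - x) \<le> norm x / 4" if "R \<le> norm x" for x
  proof -
    have "norm (W x - x) \<le> norm (J x - J0) * norm x"
      using N_near_1_apply[OF V[OF that], of x] by (simp add: W_def)
    also have "\<dots> \<le> 1/4 * norm x"
      using near[OF that] by (intro mult_right_mono) auto
    finally show ?thesis by simp
  qed
  \<comment> \<open>\<open>W\<close> moves \<open>w\<close> by at most a quarter of its norm, so the
    equation is solved within half of its norm; the solution stays in the exterior and has at least
    half the norm of \<open>w\<close>.\<close>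
  have X: "w \<in> W ` ?U \<and> norm w \<le> 2 * norm (X w)" if w: "8 * R < norm w" for w
  proof -
    have sub: "cball w (norm w / 2) \<subseteq> ?U"
    proof
      fix z assume "z \<in> cball w (norm w / 2)"
      then have "norm w \<le> norm z + norm w / 2"
        using norm_triangle_sub[of w z] by (simp add: dist_norm)
      then show "z \<in> ?U" using w by simp
    qed
    obtain x where x: "x \<in> cball w (norm w / 2)" "W x = w"
      using W_solvable[OF sub, of w] W_near[of w] w R by auto
    then have "x \<in> ?U" using sub by auto
    moreover have "norm w \<le> norm x + norm w / 2"
      using x(1) norm_triangle_sub[of w x] by (simp add: dist_norm)
    ultimately show ?thesis using x(2) X_W[of x] by auto
  qed
  have N1: "N (X a) u = u" if a: "8 * R < norm a" for a u
  proof -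
    obtain b where b: "b \<noteq> 0" "a \<bullet> b = 0" "J0 a \<bullet> b = 0" using far_line_exists[OF dim] by blast
    let ?l = "complex_line J0 a b"
    have l: "norm a \<le> norm (?l \<zeta>)" "cmod \<zeta> * norm b \<le> norm (?l \<zeta>)" for \<zeta>
      using norm_complex_line_sq[OF b(2,3), of \<zeta>] by (auto intro: power2_le_imp_le)
    have lU: "8 * R < norm (?l \<zeta>)" for \<zeta> using l(1)[of \<zeta>] a by simp
    \<comment> \<open>\<open>e\<close> is fixed before \<zeta> varies; as a test vector it makes
      \<open>h 0\<close> its own squared norm.\<close>
    define e where "e = N (X a) u - u"
    define h where "h \<zeta> = complex_coord J0 e (N (X (?l \<zeta>)) u - u)" for \<zeta>
    have hol: "h holomorphic_on UNIV"
      unfolding h_def by (rule holomorphic_on_subset[OF holomorphic_slice]) (use lU X in auto)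
    have XU: "R \<le> norm (X (?l \<zeta>))" for \<zeta>
    proof -
      have "X (?l \<zeta>) \<in> ?U" using X_in X[OF lU] by blast
      then show ?thesis using R by simp
    qed
    have hb: "cmod (h \<zeta>) \<le> 2 * norm e * norm u * norm (J (X (?l \<zeta>)) - J0)" for \<zeta>
    proof -
      let ?x = "X (?l \<zeta>)"
      have "norm (N ?x u - u) \<le> norm (J ?x - J0) * norm u"
        by (rule N_near_1_apply[OF V[OF XU]])
      then have "2 * norm e * norm (N ?x u - u) \<le> 2 * norm e * (norm (J ?x - J0) * norm u)"
        by (intro mult_left_mono) auto
      then show ?thesis
        using cmod_complex_coord_le[of e "N ?x u - u"] unfolding h_def by (simp add: mult_ac)
    qed
    have "LIM \<zeta> at_infinity. X (?l \<zeta>) :> at_infinity"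
      unfolding filterlim_at_infinity[OF order_refl] eventually_at_infinity
    proof (intro allI impI)
      fix r :: real assume "0 < r"
      have "r \<le> norm (X (?l \<zeta>))" if "2 * r / norm b \<le> cmod \<zeta>" for \<zeta>
      proof -
        have "2 * r \<le> cmod \<zeta> * norm b" using that b by (simp add: field_simps)
        then show ?thesis using l(2)[of \<zeta>] X[OF lU[of \<zeta>]] by linarith
      qed
      then show "\<exists>B. \<forall>\<zeta>. B \<le> cmod \<zeta> \<longrightarrow> r \<le> norm (X (?l \<zeta>))" by blast
    qed
    from tendsto_mult_right_zero[OF filterlim_compose[OF lim this]]
    have "((\<lambda>\<zeta>. 2 * norm e * norm u * norm (J (X (?l \<zeta>)) - J0)) \<longlongrightarrow> 0) at_infinity" .
    then have "(h \<longlongrightarrow> 0) at_infinity"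
      by (rule Lim_null_comparison[rotated]) (use hb in simp)
    from Liouville_weak_0[OF hol this, of 0] have "(norm e)\<^sup>2 = 0"
      by (simp add: h_def complex_line_def complex_coord_self flip: e_def)
    then show ?thesis by (simp add: e_def)
  qed
  show ?thesis
  proof (rule that[of "16 * R"])
    fix x :: 'a assume x: "16 * R < norm x"
    have "norm x \<le> norm (W x) + norm (W x - x)" by norm
    then have "8 * R < norm (W x)" using W_near[of x] x R by simp
    from N1[OF this] X_W[of x] x R have "N x = id_blinfun" by (intro blinfun_eqI) simp
    then show "J x = J0" using x R by (intro J_eq_J0 V) auto
  qed (use R in simp)
qed

section \<open>Rigidity in real dimension at most two\<close>

lemma J_inner: "J x v \<bullet> v = 0"
proof -
  have "J x v \<bullet> J x (J x v) = v \<bullet> J x v"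
    using norm_J[of x "v + J x v"] norm_J[of x v] norm_J[of x "J x v"]
    by (simp add: dot_norm blinfun.add_right)
  then show ?thesis by (simp add: J_square inner_commute)
qed

text \<open>The vectors \<open>v\<close>, \<open>J x v + J0 v\<close> and
  \<open>J x v - J0 v\<close> are pairwise orthogonal, so they cannot all be nonzero. Membership in
  \<open>V\<close> excludes the alternative \<open>J x = - J0\<close>.\<close>

lemma J_eq_J0_dim_le_2:
  assumes dim: "DIM('a) \<le> 2" and x: "x \<in> V"
  shows "J x = J0"
proof (rule blinfun_eqI, rule ccontr)
  fix v assume ne: "J x v \<noteq> J0 v"
  then have v: "v \<noteq> 0" by auto
  define s d where "s = J x v + J0 v" and "d = J x v - J0 v"
  have s: "s \<noteq> 0" using sum_lower_bound[OF x, of v] v by (auto simp: s_def blinfun.add_left)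
  have d: "d \<noteq> 0" using ne by (simp add: d_def)
  have "J x v \<bullet> J x v = J0 v \<bullet> J0 v" by (simp add: dot_square_norm norm_J norm_J0)
  then have o: "v \<bullet> s = 0" "v \<bullet> d = 0" "s \<bullet> d = 0"
    using J_inner[of x v] inner_J0_self[of v]
    by (simp_all add: s_def d_def inner_add_left inner_add_right inner_diff_right inner_commute)
  have "v \<noteq> s" "v \<noteq> d" "s \<noteq> d" using o v s d by auto
  then have "card {v, s, d} = 3" by simp
  moreover have "independent {v, s, d}"
    using o v s d by (intro pairwise_orthogonal_independent) (auto simp: pairwise_def orthogonal_def inner_commute)
  ultimately show False using independent_bound[of "{v, s, d}"] dim by simp
qed

lemma eventually_J0:
  assumes lim: "((\<lambda>x. norm (J x - J0)) \<longlongrightarrow> 0) at_infinity"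
  obtains R where "0 < R" "\<And>x. R < norm x \<Longrightarrow> J x = J0"
proof (cases "3 \<le> DIM('a)")
  case True
  then show ?thesis using eventually_J0_dim_ge_3[OF _ lim] that by blast
next
  case False
  obtain R0 where R0: "\<And>x. R0 \<le> norm x \<Longrightarrow> norm (J x - J0) < 1/2"
    using lim[unfolded Lim_at_infinity, rule_format, of "1/2"] by auto
  show ?thesis
  proof (rule that[of "max 1 R0"])
    fix x :: 'a assume "max 1 R0 < norm x"
    then show "J x = J0" using R0[of x] False by (intro J_eq_J0_dim_le_2) (auto simp: V_def)
  qed simp
qed

text \<open>By continuity \<open>J p = J0\<close>, so a chart around \<open>p\<close> exists. Its
  points are joined by complex lines to one where \<open>J = J0\<close> holds on a neighbourhood,
  and the identity theorem carries the equality along these lines.\<close>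

lemma unique_continuation:
  assumes p: "p \<in> closure (interior {x. J x = J0})"
  shows "p \<in> interior {x. J x = J0}"
proof -
  let ?Z = "{x. J x = J0}"
  have "closed ?Z"
    by (intro closed_Collect_eq continuous_on_J continuous_intros)
  then have Jp: "J p = J0"
    using p by (metis (mono_tags) closure_minimal interior_subset mem_Collect_eq subsetD)
  obtain r1 where r1: "r1 > 0" "\<And>x. dist x p < r1 \<Longrightarrow> dist (J x) (J p) < 1/4"
    using continuous_on_J[of UNIV] unfolding continuous_on_iff by (metis UNIV_I zero_less_divide_1_iff zero_less_numeral)
  obtain r2 where r2: "r2 > 0" "\<And>x. dist x p < r2 \<Longrightarrow> dist (J' x) (J' p) < 1"
    using continuous_J' unfolding continuous_on_iff by (metis UNIV_I zero_less_one)
  define K where "K = norm (J' p) + 1"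
  have K: "K > 0" by (simp add: K_def add_nonneg_pos)
  \<comment> \<open>The three bounds keep \<open>J\<close> within 1/4 of \<open>J0\<close>, keep the
    norm of \<open>J'\<close> below \<open>K\<close>, and make \<open>r * K\<close> at most 1/4, as
    \<open>ball_chart\<close> demands.\<close>
  define r where "r = min (min r1 r2) (1 / (4 * K))"
  have r: "r > 0" "r \<le> r1" "r \<le> r2" "r * K \<le> 1/4"
  proof -
    have "r * K \<le> 1 / (4 * K) * K" using K by (intro mult_right_mono) (auto simp: r_def)
    then show "r * K \<le> 1/4" using K by simp
  qed (use r1 r2 K in \<open>auto simp: r_def\<close>)
  have near: "norm (J x - J0) \<le> 1/4" if "x \<in> ball p r" for x
    using r1(2)[of x] that r(2) by (simp add: dist_norm norm_minus_commute Jp)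
  have chart: "twistor_chart J0 J N N' (ball p r) p"
  proof (rule ball_chart[OF near])
    fix x assume "x \<in> ball p r"
    then have "norm (J' x - J' p) < 1" using r2(2)[of x] r(3) by (simp add: dist_norm norm_minus_commute)
    then have "norm (J' x) \<le> K" unfolding K_def using norm_triangle_sub[of "J' x" "J' p"] by simp
    then have "r * norm (J' x) \<le> r * K" using r(1) by (intro mult_left_mono) auto
    then show "r * norm (J' x) \<le> 1/4" using r(4) by simp
  qed
  interpret twistor_chart J0 J N N' "ball p r" p by (rule chart)
  have sub: "ball 0 (r/2) \<subseteq> W ` ball p r" by (rule ball_subset_chart[OF chart])
  have V: "ball p r \<subseteq> V" using near by (force simp: V_def)
  \<comment> \<open>Distances from \<open>p\<close> grow by a factor of at most 3/2, which leads
    from \<open>r / 4\<close> to \<open>3 * r / 8\<close>.\<close>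
  have Wb: "W x \<in> ball 0 (r/2)" if x: "x \<in> ball p (r/4)" for x
  proof -
    have "norm (W x) \<le> norm (x - p) + norm (W x - W p - (x - p))" by (simp add: W_p) norm
    also have "norm (W x - W p - (x - p)) \<le> norm (x - p) / 2"
      using lipschitz[of x p] x r(1) by (simp add: W_def)
    finally show ?thesis using x r(1) by (simp add: dist_norm norm_minus_commute)
  qed
  obtain z where z: "z \<in> interior ?Z" "z \<in> ball p (r/4)"
    using p r(1) unfolding closure_approachable by (metis dist_commute divide_pos_pos mem_ball zero_less_numeral)
  have zr: "z \<in> ball p r" using z(2) r(1) by auto
  define w1 where "w1 = W z"
  have w1: "w1 \<in> ball 0 (r/2)" "X w1 = z" using Wb[OF z(2)] X_W[OF zr] by (auto simp: w1_def)
  have "open (W ` ball p r \<inter> X -` interior ?Z)"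
    using continuous_open_preimage[OF continuous_on_X open_image_W open_interior] .
  moreover have "w1 \<in> W ` ball p r \<inter> X -` interior ?Z" using w1 z sub by auto
  ultimately obtain \<delta> where \<delta>: "\<delta> > 0" "ball w1 \<delta> \<subseteq> W ` ball p r \<inter> X -` interior ?Z"
    by (meson open_contains_ball)
  have N1: "N (X w) u = u" if w: "w \<in> ball 0 (r/2)" for w u
  proof -
    define e where "e = N (X w) u - u"
    \<comment> \<open>Parameter 0 gives \<open>w1\<close>, near which the slice vanishes, and
      parameter 1 gives the target \<open>w\<close>.\<close>
    let ?l = "complex_line J0 w1 (w - w1)"
    define h where "h \<zeta> = complex_coord J0 e (N (X (?l \<zeta>)) u - u)" for \<zeta>
    define S where "S = ?l -` ball 0 (r/2)"
    have oS: "open S"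
      unfolding S_def using continuous_on_complex_line[of UNIV] by (auto intro: open_vimage)
    have "convex S"
    proof (rule convexI)
      fix x y :: complex and s t :: real assume st: "0 \<le> s" "0 \<le> t" "s + t = 1" and xy: "x \<in> S" "y \<in> S"
      have "?l (s *\<^sub>R x + t *\<^sub>R y) = s *\<^sub>R ?l x + t *\<^sub>R ?l y"
        unfolding complex_line_def using st(3)
        by (simp add: algebra_simps flip: scaleR_add_left)
      then show "s *\<^sub>R x + t *\<^sub>R y \<in> S"
        using convexD[OF convex_ball _ _ st] xy unfolding S_def by (metis vimageI2 vimageE)
    qed
    have hol: "h holomorphic_on S"
      unfolding h_def by (rule holomorphic_on_subset[OF holomorphic_slice]) (use sub in \<open>auto simp: S_def\<close>)
    have in_S: "0 \<in> S" "1 \<in> S" using w w1 by (auto simp: S_def complex_line_def)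
    define Q where "Q = S \<inter> ?l -` ball w1 \<delta>"
    have oQ: "open Q"
      unfolding Q_def using continuous_on_complex_line[of UNIV] oS
      by (intro open_Int open_vimage) auto
    have "0 \<in> Q" using \<delta>(1) in_S by (auto simp: Q_def complex_line_def)
    have "h 1 = 0"
    proof (rule analytic_continuation[OF hol oS convex_connected[OF \<open>convex S\<close>] _ in_S(1) _ _ in_S(2)])
      show "Q \<subseteq> S" by (auto simp: Q_def)
      show "0 islimpt Q" using oQ \<open>0 \<in> Q\<close> by (simp add: interior_limit_point interior_open)
      fix \<zeta> assume "\<zeta> \<in> Q"
      then have "?l \<zeta> \<in> ball w1 \<delta>" by (simp add: Q_def)
      then have "X (?l \<zeta>) \<in> interior ?Z" using \<delta>(2) by blast
      then have "J (X (?l \<zeta>)) = J0" using interior_subset by blast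
      then show "h \<zeta> = 0" by (simp add: h_def N_eq_id complex_coord_def zero_complex.code)
    qed
    then have "(norm e)\<^sup>2 = 0"
      by (simp add: h_def complex_line_def complex_coord_self flip: e_def)
    then show ?thesis by (simp add: e_def)
  qed
  have "J x = J0" if x: "x \<in> ball p (r/4)" for x
  proof -
    have xr: "x \<in> ball p r" using x r(1) by auto
    have "N x = id_blinfun" using N1[OF Wb[OF x]] X_W[OF xr] by (intro blinfun_eqI) simp
    then show ?thesis using V xr by (intro J_eq_J0) auto
  qed
  then show ?thesis using r(1) by (intro interiorI[of "ball p (r/4)"]) auto
qed

text \<open>The interior of the coincidence set is open, closed by
  \<open>unique_continuation\<close>, and contains every point far enough out; connectedness
  finishes.\<close>

theorem asymptotically_J0_imp_J0:
  assumes lim: "((\<lambda>x. norm (J x - J0)) \<longlongrightarrow> 0) at_infinity"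
  shows "J x = J0"
proof -
  let ?I = "interior {x. J x = J0}"
  obtain R where R: "0 < R" "\<And>x. R < norm x \<Longrightarrow> J x = J0" using eventually_J0[OF lim] by blast
  obtain y :: 'a where "norm y = R + 1" using vector_choose_size[of "R + 1"] R(1) by auto
  moreover have "open {x::'a. R < norm x}" by (intro open_Collect_less continuous_intros)
  ultimately have "y \<in> ?I" using R(2) by (intro interiorI[of "{x. R < norm x}"]) auto
  moreover have "closed ?I" using unique_continuation closure_subset_eq by blast
  ultimately have "?I = UNIV" using connected_UNIV unfolding connected_clopen
    by (metis clopen empty_iff open_interior)
  then show ?thesis using interior_subset by blast
qed

end

section \<open>Constancy and the standard structure\<close>

lemma orthogonal_complex_inner:
  fixes J0 :: "'a::euclidean_space \<Rightarrow>\<^sub>L 'a"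
  assumes "\<And>v. J0 (J0 v) = - v" "orthogonal_transformation J0"
  shows "J0 v \<bullet> w = - (v \<bullet> J0 w)"
proof -
  have "J0 (J0 v) \<bullet> J0 w = J0 v \<bullet> w"
    using assms(2) by (simp add: orthogonal_transformation_def)
  then show ?thesis by (simp add: assms(1))
qed

text \<open>Integrability gives a symmetry of the defect \<open>A\<close>; differentiating skewness
  and \<open>J\<^sup>2 = -1\<close> gives a skew-symmetry. Together they force it to vanish.\<close>

lemma integrable_imp_derivative_J:
  fixes J :: "'a::euclidean_space \<Rightarrow> 'a \<Rightarrow>\<^sub>L 'a"
  assumes ocs: "orthogonal_complex_structure J"
    and J': "\<And>x. (J has_derivative blinfun_apply (J' x)) (at x)"
  shows "J' x (J x v) u = J x (J' x v u)"
proof -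
  have sq: "J y (J y v) = - v" for y v
    using ocs by (simp add: orthogonal_complex_structure_def almost_complex_structure_def)
  have orth: "orthogonal_transformation (J y)" for y
    using ocs by (simp add: orthogonal_complex_structure_def)
  have skew: "J y v \<bullet> w = - (v \<bullet> J y w)" for y v w
    using orthogonal_complex_inner[OF sq orth] .
  have dJ: "((\<lambda>p. J p u) has_derivative (\<lambda>h. J' x h u)) (at x)" for u
    by (rule derivative_eq_intros J' refl)+ simp
  have fd: "frechet_derivative (\<lambda>p. J p u) (at x) = (\<lambda>h. J' x h u)" for u
    using frechet_derivative_at[OF dJ] by simp
  have fc: "frechet_derivative (\<lambda>p. u) (at x) = (\<lambda>h. 0)" for u :: 'a
    using frechet_derivative_at[OF has_derivative_const] by simp
  have C1: "C1_map (\<lambda>p::'a. u)" for u :: 'a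
    unfolding C1_map_def by (rule exI[of _ "\<lambda>_. 0"]) (simp add: zero_blinfun.rep_eq)
  \<comment> \<open>For constant fields the brackets contain only derivatives of \<open>J\<close>,
    so the Nijenhuis tensor becomes algebraic in \<open>J\<close> and \<open>J'\<close>.\<close>
  have nij: "J' x (J x u) v - J' x (J x v) u + J x (J' x v u) - J x (J' x u v) = 0" for u v
  proof -
    have "nijenhuis J (\<lambda>_. u) (\<lambda>_. v) x = 0"
      using ocs C1 by (simp add: orthogonal_complex_structure_def integrable_acs_def)
    then show ?thesis by (simp add: nijenhuis_def lie_bracket_def fd fc blinfun.minus_right)
  qed
  have J'_skew: "J' x h v \<bullet> w = - (v \<bullet> J' x h w)" for h v w
  proof -
    have 1: "((\<lambda>p. J p v \<bullet> w) has_derivative (\<lambda>h. J' x h v \<bullet> w)) (at x)"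
      by (rule derivative_eq_intros dJ refl)+ simp
    have "((\<lambda>p. - (v \<bullet> J p w)) has_derivative (\<lambda>h. - (v \<bullet> J' x h w))) (at x)"
      by (rule derivative_eq_intros dJ refl)+ simp
    from fun_cong[OF has_derivative_unique[OF 1[unfolded skew] this], of h] show ?thesis .
  qed
  have J'_anti: "J' x h (J x v) = - J x (J' x h v)" for h v
  proof -
    have 1: "((\<lambda>p. J p (J p v)) has_derivative (\<lambda>h. J x (J' x h v) + J' x h (J x v))) (at x)"
      by (rule derivative_eq_intros J' refl)+ simp
    have "((\<lambda>p. J p (J p v)) has_derivative (\<lambda>h. 0)) (at x)"
      unfolding sq by (rule has_derivative_const)
    from fun_cong[OF has_derivative_unique[OF 1 this], of h] show ?thesis
      by (simp add: eq_neg_iff_add_eq_0 add.commute)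
  qed
  \<comment> \<open>\<open>A u v \<bullet> w\<close> is symmetric in \<open>u, v\<close> and skew in \<open>v, w\<close>, hence zero.\<close>
  define A where "A u v = J' x (J x u) v - J x (J' x u v)" for u v
  have A_sym: "A u v = A v u" for u v using nij[of u v] by (simp add: A_def algebra_simps)
  have A_skew: "A u v \<bullet> w = - (v \<bullet> A u w)" for u v w
  proof -
    have "J x (J' x u v) \<bullet> w = v \<bullet> J' x u (J x w)"
      using skew[of x "J' x u v" w] J'_skew[of u v "J x w"] by simp
    then have "J x (J' x u v) \<bullet> w = - (v \<bullet> J x (J' x u w))" by (simp add: J'_anti)
    then show ?thesis
      using J'_skew[of "J x u" v w] by (simp add: A_def inner_diff_left inner_diff_right)
  qed
  have A0: "A v u = 0"
  proof -
    have "A v u \<bullet> w = 0" for w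
    proof -
      have swap: "A a b \<bullet> c = - (A a c \<bullet> b)" for a b c
        using A_skew[of a b c] by (simp add: inner_commute)
      \<comment> \<open>Three skew swaps alternating with three symmetric ones return to the
        starting term with the opposite sign.\<close>
      have "A v u \<bullet> w = - (A w v \<bullet> u)" using swap[of v u w] A_sym[of v w] by simp
      also have "\<dots> = A u w \<bullet> v" using swap[of w v u] A_sym[of w u] by simp
      also have "\<dots> = - (A v u \<bullet> w)" using swap[of u w v] A_sym[of u v] by simp
      finally show ?thesis by simp
    qed
    then show ?thesis using inner_eq_zero_iff by blast
  qed
  then show ?thesis by (simp add: A_def)
qed

theorem asymptotically_constant_imp_constant:
  fixes J :: "'a::euclidean_space \<Rightarrow> 'a \<Rightarrow>\<^sub>L 'a"
  assumes "C1_map J" "orthogonal_complex_structure J" "asymptotically_constant J"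
  obtains J0 :: "'a \<Rightarrow>\<^sub>L 'a" where "\<And>v. J0 (J0 v) = - v" "orthogonal_transformation J0" "\<And>x. J x = J0"
proof -
  obtain J' where J': "\<And>x. (J has_derivative blinfun_apply (J' x)) (at x)" "continuous_on UNIV J'"
    using assms(1) unfolding C1_map_def by blast
  obtain J0 :: "'a \<Rightarrow>\<^sub>L 'a" where J0: "orthogonal_complex_structure (\<lambda>_::'a. J0)"
      and lim: "((\<lambda>x. norm (J x - J0)) \<longlongrightarrow> 0) at_infinity"
    using assms(3) unfolding asymptotically_constant_def by blast
  have J0': "J0 (J0 v) = - v" "orthogonal_transformation J0" for v
    using J0 by (auto simp: orthogonal_complex_structure_def almost_complex_structure_def)
  interpret holomorphic_structure J0 J J'
  proof
    show "J' x (J x v) u = J x (J' x v u)" for x v u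
      by (rule integrable_imp_derivative_J[OF assms(2) J'(1)])
  qed (use assms(2) J0' J' in \<open>auto simp: orthogonal_complex_structure_def
      almost_complex_structure_def orthogonal_transformation_norm\<close>)
  show ?thesis using that J0' asymptotically_J0_imp_J0[OF lim] by blast
qed

section \<open>Unitary frames and conjugation to the standard structure\<close>

lemma unitary_frame_exists:
  fixes J0 :: "'a::euclidean_space \<Rightarrow>\<^sub>L 'a"
  assumes sq: "\<And>v. J0 (J0 v) = - v" and orth: "orthogonal_transformation J0"
  obtains E where "finite E" "2 * card E = DIM('a)"
    "\<And>u v. u \<in> E \<Longrightarrow> v \<in> E \<Longrightarrow> u \<bullet> v = (if u = v then 1 else 0)"
    "\<And>u v. u \<in> E \<Longrightarrow> v \<in> E \<Longrightarrow> u \<bullet> J0 v = 0"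
proof -
  have skew: "J0 v \<bullet> w = - (v \<bullet> J0 w)" for v w by (rule orthogonal_complex_inner[OF sq orth])
  have iso: "J0 v \<bullet> J0 w = v \<bullet> w" for v w using skew[of v "J0 w"] by (simp add: sq)
  have self: "v \<bullet> J0 v = 0" for v using skew[of v v] by (simp add: inner_commute)
  define frame where "frame E \<longleftrightarrow> finite E \<and> (\<forall>u\<in>E. \<forall>v\<in>E. u \<bullet> v = (if u = v then 1 else 0))
     \<and> (\<forall>u\<in>E. \<forall>v\<in>E. u \<bullet> J0 v = 0)" for E :: "'a set"
  have indep: "independent (E \<union> J0 ` E) \<and> card (E \<union> J0 ` E) = 2 * card E" if "frame E" for E
  proof
    have nz: "0 \<notin> E \<union> J0 ` E"
    proof
      assume "0 \<in> E \<union> J0 ` E"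
      then obtain v where "v \<in> E" "v = 0 \<or> J0 v = 0" by force
      then have "v \<bullet> v = 1" "v \<bullet> v = 0" using that iso[of v v] by (auto simp: frame_def)
      then show False by simp
    qed
    have "pairwise orthogonal (E \<union> J0 ` E)"
      using that by (auto simp: pairwise_def orthogonal_def frame_def skew sq split: if_splits) metis
    then show "independent (E \<union> J0 ` E)" using nz by (rule pairwise_orthogonal_independent)
    have "E \<inter> J0 ` E = {}"
    proof (rule ccontr)
      assume "E \<inter> J0 ` E \<noteq> {}"
      then obtain v where v: "v \<in> E" "J0 v \<in> E" by auto
      have "J0 v \<bullet> J0 v = 1" using that v(2) by (simp add: frame_def)
      moreover have "J0 v \<bullet> J0 v = 0" using that v unfolding frame_def by blast
      ultimately show False by simp
    qed
    moreover have "inj_on J0 E" by (rule inj_onI) (metis sq minus_equation_iff)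
    ultimately show "card (E \<union> J0 ` E) = 2 * card E"
      using that by (simp add: card_Un_disjoint card_image frame_def)
  qed
  have bound: "2 * card E \<le> DIM('a)" if "frame E" for E
    using indep[OF that] independent_bound by fastforce
  have ex: "frame {}" by (simp add: frame_def)
  \<comment> \<open>A frame of greatest size exists by \<open>bound\<close>. If it failed to span
    together with its \<open>J0\<close>-image, a unit vector orthogonal to that span would enlarge
    it.\<close>
  obtain E where E: "frame E" "\<And>F. frame F \<Longrightarrow> card F \<le> card E"
    using ex_has_greatest_nat[of frame "{}" card "DIM('a)"] ex bound by fastforce
  have "span (E \<union> J0 ` E) = UNIV"
  proof (rule ccontr)
    assume "span (E \<union> J0 ` E) \<noteq> UNIV"
    then have "span (E \<union> J0 ` E) \<subset> UNIV" by auto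
    then obtain w where w: "w \<noteq> 0" "\<And>y. y \<in> span (E \<union> J0 ` E) \<Longrightarrow> orthogonal w y"
      using orthogonal_to_subspace_exists_gen[of "E \<union> J0 ` E" UNIV] by auto
    define e where "e = w /\<^sub>R norm w"
    have e: "e \<bullet> e = 1" using w(1) by (simp add: e_def dot_square_norm power2_eq_square)
    have o: "e \<bullet> v = 0" "e \<bullet> J0 v = 0" if "v \<in> E" for v
      using w(2)[of v] w(2)[of "J0 v"] that by (auto simp: e_def orthogonal_def span_base)
    have o': "v \<bullet> e = 0" "v \<bullet> J0 e = 0" if "v \<in> E" for v
      using o[OF that] skew[of e v] by (simp_all add: inner_commute)
    have "e \<notin> E" using o e by fastforce
    have "frame (insert e E)"
      unfolding frame_def
    proof (intro conjI ballI)
      fix u v assume uv: "u \<in> insert e E" "v \<in> insert e E"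
      show "u \<bullet> v = (if u = v then 1 else 0)"
        using uv e o o' E(1) \<open>e \<notin> E\<close> by (auto simp: frame_def)
      show "u \<bullet> J0 v = 0"
        using uv o o' E(1) self by (auto simp: frame_def)
    qed (use E(1) in \<open>simp add: frame_def\<close>)
    then have "card (insert e E) \<le> card E" by (rule E(2))
    moreover have "finite E" using E(1) by (simp add: frame_def)
    ultimately show False using \<open>e \<notin> E\<close> by simp
  qed
  then have "card (E \<union> J0 ` E) = DIM('a)"
    using dim_span_eq_card_independent[of "E \<union> J0 ` E"] indep[OF E(1)] by simp
  then have "2 * card E = DIM('a)" using indep[OF E(1)] by simp
  moreover have "finite E" using E(1) by (simp add: frame_def)
  ultimately show ?thesis using E(1) unfolding frame_def by (intro that[of E]) blast+
qed

text \<open>A unitary frame has as many elements as there are complex coordinates, so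
  \<open>T\<close> can send the standard complex basis to it, with \<open>J0\<close> playing the
  role of multiplication by \<open>\<i>\<close>.\<close>

lemma unitary_equivalence:
  fixes J0 :: "(complex ^ 'n) \<Rightarrow>\<^sub>L (complex ^ 'n)"
  assumes sq: "\<And>v. J0 (J0 v) = - v" and orth: "orthogonal_transformation J0"
  obtains T :: "complex ^ 'n \<Rightarrow> complex ^ 'n" where "orthogonal_transformation T" "\<And>z. T (\<i> *s z) = J0 (T z)"
proof -
  obtain E where E: "finite E" "2 * card E = DIM(complex ^ 'n)"
    "\<And>u v. u \<in> E \<Longrightarrow> v \<in> E \<Longrightarrow> u \<bullet> v = (if u = v then 1 else 0)"
    "\<And>u v. u \<in> E \<Longrightarrow> v \<in> E \<Longrightarrow> u \<bullet> J0 v = 0"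
    using unitary_frame_exists[OF sq orth] by blast
  have "card (UNIV :: 'n set) = card E" using E(2) by simp
  then obtain \<sigma> where \<sigma>: "bij_betw \<sigma> (UNIV :: 'n set) E"
    using finite_same_card_bij[of "UNIV :: 'n set" E] E(1) by auto
  have skew: "J0 v \<bullet> w = - (v \<bullet> J0 w)" for v w by (rule orthogonal_complex_inner[OF sq orth])
  have \<sigma>E: "\<sigma> i \<in> E" for i using \<sigma> by (auto simp: bij_betw_def)
  have inj: "\<sigma> i = \<sigma> j \<longleftrightarrow> i = j" for i j using \<sigma> by (auto simp: bij_betw_def inj_eq)
  have ip: "\<sigma> i \<bullet> \<sigma> j = (if i = j then 1 else 0)" "\<sigma> i \<bullet> J0 (\<sigma> j) = 0"
    "J0 (\<sigma> i) \<bullet> \<sigma> j = 0" "J0 (\<sigma> i) \<bullet> J0 (\<sigma> j) = (if i = j then 1 else 0)" for i j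
    using E(3,4)[OF \<sigma>E \<sigma>E] skew by (simp_all add: inj sq)
  define T where "T z = (\<Sum>i\<in>UNIV. Re (z $ i) *\<^sub>R \<sigma> i + Im (z $ i) *\<^sub>R J0 (\<sigma> i))" for z :: "complex ^ 'n"
  have lin: "linear T"
    by (rule linearI) (simp_all add: T_def scaleR_add_left sum.distrib scaleR_sum_right algebra_simps)
  have "T z \<bullet> T w = z \<bullet> w" for z w
  proof -
    have "T z \<bullet> T w = (\<Sum>i\<in>UNIV. \<Sum>j\<in>UNIV. if i = j then Re (z $ i) * Re (w $ j) + Im (z $ i) * Im (w $ j) else 0)"
      unfolding T_def inner_sum_left inner_sum_right
      by (intro sum.cong refl) (simp add: inner_add_left inner_add_right ip)
    also have "\<dots> = z \<bullet> w" by (simp add: inner_vec_def inner_complex_def)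
    finally show ?thesis .
  qed
  then have "orthogonal_transformation T" using lin by (simp add: orthogonal_transformation_def)
  moreover have "T (\<i> *s z) = J0 (T z)" for z
    by (simp add: T_def blinfun.sum_right blinfun.add_right blinfun.scaleR_right sq algebra_simps)
  ultimately show ?thesis by (rule that)
qed

theorem theorem1p5:
  fixes J :: "complex ^ 'n \<Rightarrow> (complex ^ 'n) \<Rightarrow>\<^sub>L (complex ^ 'n)"
  assumes "C1_map J"
    and "orthogonal_complex_structure J"
    and "asymptotically_constant J"
  shows "isometrically_equivalent J (\<lambda>_. standard_complex_structure) \<or>
         isometrically_equivalent (\<lambda>x. - J x) (\<lambda>_. standard_complex_structure)"
\<comment> \<open>Isometries may reverse orientation, so a constant structure of either orientation
  is conjugate to the standard one without a change of sign.\<close>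
proof (rule disjI1)
  obtain J0 :: "(complex ^ 'n) \<Rightarrow>\<^sub>L (complex ^ 'n)"
    where J0: "\<And>v. J0 (J0 v) = - v" "orthogonal_transformation J0" "\<And>x. J x = J0"
    using asymptotically_constant_imp_constant[OF assms] by blast
  obtain T :: "complex ^ 'n \<Rightarrow> complex ^ 'n" where T: "orthogonal_transformation T" "\<And>z. T (\<i> *s z) = J0 (T z)"
    using unitary_equivalence[OF J0(1,2)] by blast
  \<comment> \<open>\<open>T\<close> carries the standard structure to \<open>J0\<close>; the
    equivalence asks for the opposite direction.\<close>
  define S where "S = inv T"
  have bij: "bij T" using T(1) by (rule orthogonal_transformation_bij)
  have S: "orthogonal_transformation S" unfolding S_def using T(1) by (rule orthogonal_transformation_inv)
  have "(S has_derivative S) (at x)" for x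
    using S by (simp add: orthogonal_transformation_linear linear_imp_has_derivative)
  then have fd: "frechet_derivative S (at x) = S" for x by (metis frechet_derivative_at)
  have "inv S = T" unfolding S_def using bij by (rule inv_inv_eq)
  moreover have "S (J0 (T v)) = \<i> *s v" for v
    unfolding T(2)[symmetric] S_def using bij by (simp add: bij_is_inj)
  ultimately have "blinfun_apply standard_complex_structure
      = frechet_derivative S (at x) \<circ> blinfun_apply (J x) \<circ> inv (frechet_derivative S (at x))" for x
    by (simp add: fd J0(3) standard_complex_structure.rep_eq fun_eq_iff)
  moreover have "euclidean_isometry S"
    unfolding euclidean_isometry_def
    using S orthogonal_transformation_surj orthogonal_transformation_isometry by blast
  ultimately show "isometrically_equivalent J (\<lambda>_. standard_complex_structure)"
    unfolding isometrically_equivalent_def by blast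
qed

end
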